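(* The space $\mathrm{TFAB}_\omega$ of torsion-free abelian groups with domain $\omega$ is Borel complete. In fact, there exists a continuous map $\mathbf{B}: \mathrm{Graph}_\omega \rightarrow \mathrm{TFAB}_\omega$ such that for every $H_1, H_2 \in \mathrm{Graph}_\omega$: $$H_1 \cong H_2 \text{ if and only if } \mathbf{B}(H_1) \cong \mathbf{B}(H_2).$$
   Context: For a countable first-order language $L$, $\mathrm{K}^L_\omega$ denotes the set of $L$-structures with domain $\omega$, with its usual topology (and the induced standard Borel structure): a structure is identified with the family of its relations and (graphs of) functions on $\omega$, viewed as a point of a countable product of spaces of the form $2^{\omega^n}$ or $\omega^{\omega^n}$ with the product topology (so that basic open sets are given by finitely many atomic or negated atomic conditions with parameters from $\omega$). Borel subsets of $\mathrm{K}^L_\omega$ carry the induced topology and Borel structure. $\mathrm{Graph}_\omega$ is the space of graphs (irreflexive symmetric binary relations) with domain $\omega$; $\mathrm{TFAB}_\omega$ is the space of torsion-free abelian groups with domain $\omega$ (as structures in the language of groups). A Borel class $\mathrm{K}_1$ of structures with domain $\omega$ is called Borel complete if for every Borel class $\mathrm{K}_2$ of structures (in a countable language) with domain $\omega$ there is a Borel map $\mathbf{F}: \mathrm{K}_2 \rightarrow \mathrm{K}_1$ such that for all $A, B \in \mathrm{K}_2$: $A \cong B \Leftrightarrow \mathbf{F}(A) \cong \mathbf{F}(B)$. *)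

theory Defs
  imports "HOL-Analysis.Analysis" "HOL-Algebra.Group"
begin

(* Symbols are natural numbers, so that one can quantify over all countable first-order languages
   inside a formula.  Arity 0 is allowed: constants are function symbols of arity 0.  Arities of
   numbers that are not symbols are irrelevant. *)
record fo_language =
  rel_syms :: "nat set"
  rel_arity :: "nat \<Rightarrow> nat"
  fun_syms :: "nat set"
  fun_arity :: "nat \<Rightarrow> nat"

(* Interpretations of the relation symbols and of the function symbols on the domain nat; a tuple
   in nat^n is a list of length n. *)
type_synonym fo_structure = "(nat \<Rightarrow> nat list \<Rightarrow> bool) \<times> (nat \<Rightarrow> nat list \<Rightarrow> nat)"

definition tuples :: "nat \<Rightarrow> nat list set"
  where "tuples n = {xs. length xs = n}"

(* Extensional functions are used, so that each structure has exactly one representative. *)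
definition structures :: "fo_language \<Rightarrow> fo_structure set"
  where "structures L =
    (\<Pi>\<^sub>E R\<in>rel_syms L. tuples (rel_arity L R) \<rightarrow>\<^sub>E UNIV) \<times>
    (\<Pi>\<^sub>E f\<in>fun_syms L. tuples (fun_arity L f) \<rightarrow>\<^sub>E UNIV)"

definition structure_topology :: "fo_language \<Rightarrow> fo_structure topology"
  where "structure_topology L =
    prod_topology
      (product_topology
        (\<lambda>R. product_topology (\<lambda>_. discrete_topology UNIV) (tuples (rel_arity L R)))
        (rel_syms L))
      (product_topology
        (\<lambda>f. product_topology (\<lambda>_. discrete_topology UNIV) (tuples (fun_arity L f)))
        (fun_syms L))"

lemma topspace_structure_topology [simp]: "topspace (structure_topology L) = structures L"
  by (simp add: structure_topology_def structures_def)

definition class_topology :: "fo_language \<Rightarrow> fo_structure set \<Rightarrow> fo_structure topology"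
  where "class_topology L K = subtopology (structure_topology L) K"

definition borel_of :: "'a topology \<Rightarrow> 'a measure"
  where "borel_of X = sigma (topspace X) {U. openin X U}"

definition isomorphic :: "fo_language \<Rightarrow> fo_structure \<Rightarrow> fo_structure \<Rightarrow> bool"
  where "isomorphic L A B \<longleftrightarrow> (\<exists>h :: nat \<Rightarrow> nat. bij h \<and>
    (\<forall>R\<in>rel_syms L. \<forall>xs\<in>tuples (rel_arity L R). fst A R xs \<longleftrightarrow> fst B R (map h xs)) \<and>
    (\<forall>f\<in>fun_syms L. \<forall>xs\<in>tuples (fun_arity L f). h (snd A f xs) = snd B f (map h xs)))"

definition borel_class :: "fo_language \<Rightarrow> fo_structure set \<Rightarrow> bool"
  where "borel_class L K \<longleftrightarrow> K \<in> sets (borel_of (structure_topology L))"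

definition borel_complete :: "fo_language \<Rightarrow> fo_structure set \<Rightarrow> bool"
  where "borel_complete L1 K1 \<longleftrightarrow> borel_class L1 K1 \<and>
    (\<forall>L2 K2. borel_class L2 K2 \<longrightarrow>
      (\<exists>F \<in> measurable (borel_of (class_topology L2 K2)) (borel_of (class_topology L1 K1)).
        \<forall>A\<in>K2. \<forall>B\<in>K2. isomorphic L2 A B \<longleftrightarrow> isomorphic L1 (F A) (F B)))"

definition graph_language :: fo_language
  where "graph_language =
    \<lparr>rel_syms = {0}, rel_arity = (\<lambda>_. 2), fun_syms = {}, fun_arity = (\<lambda>_. 0)\<rparr>"

definition Graph_omega :: "fo_structure set"
  where "Graph_omega = {H \<in> structures graph_language.
    (\<forall>x. \<not> fst H 0 [x, x]) \<and> (\<forall>x y. fst H 0 [x, y] \<longrightarrow> fst H 0 [y, x])}"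

(* Symbol 0 is the group operation, symbol 1 the inverse, symbol 2 the neutral element. *)
definition group_language :: fo_language
  where "group_language =
    \<lparr>rel_syms = {}, rel_arity = (\<lambda>_. 0),
     fun_syms = {0, 1, 2}, fun_arity = (\<lambda>f. if f = 0 then 2 else if f = 1 then 1 else 0)\<rparr>"

definition group_of :: "fo_structure \<Rightarrow> nat monoid"
  where "group_of A =
    \<lparr>carrier = UNIV, mult = (\<lambda>x y. snd A 0 [x, y]), one = snd A 2 []\<rparr>"

definition torsion_free :: "('a, 'b) monoid_scheme \<Rightarrow> bool"
  where "torsion_free G \<longleftrightarrow>
    (\<forall>x\<in>carrier G. \<forall>n::nat. 0 < n \<and> x [^]\<^bsub>G\<^esub> n = \<one>\<^bsub>G\<^esub> \<longrightarrow> x = \<one>\<^bsub>G\<^esub>)"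

definition TFAB_omega :: "fo_structure set"
  where "TFAB_omega = {A \<in> structures group_language.
    comm_group (group_of A) \<and> (\<forall>x. snd A 1 [x] = inv\<^bsub>group_of A\<^esub> x) \<and>
    torsion_free (group_of A)}"

end

theory Submission
  imports Defs "HOL-Library.Function_Algebras"
begin

text \<open>
  A countable structure is a set \<open>S\<close> of tagged tuples of natural numbers, up to the action of
  \<open>Sym \<omega>\<close>. Suppose that a left-ordered countable group \<open>\<Gamma>\<close> acts on \<open>\<omega>\<close> with dense image in
  \<open>Sym \<omega>\<close>. A product of two finitely supported elements of \<open>\<rat>[\<Gamma>]\<close> has a largest and a smallest
  group element in its support, so the units of \<open>\<rat>[\<Gamma>]\<close> are the \<open>c g\<close> with \<open>c \<noteq> 0\<close> and \<open>g \<in> \<Gamma>\<close>.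

  Take countably many levels, each a copy of \<open>\<rat>[\<Gamma>] \<oplus> \<rat>[\<Gamma> \<squnion> tagged tuples]\<close>, and consider the sequences
  that are eventually constant with limit in \<open>\<rat>[tagged tuples]\<close>. Countably many subspaces make a
  linear automorphism act on the level \<open>n\<close> as a unit \<open>c\<^sub>n g\<^sub>n\<close>. Since constant sequences must go to
  eventually constant ones, the \<open>g\<^sub>n\<close> converge pointwise to a permutation \<open>\<sigma>\<close> of \<open>\<omega>\<close>; by density every
  \<open>\<sigma>\<close> arises. One more subspace, the sequences with limit in \<open>\<rat>[S]\<close>, records \<open>S\<close>. Finally a
  torsion-free group remembers a subspace as its \<open>p\<close>-divisible part, with one prime \<open>p\<close> for each
  subspace.
\<close>

section \<open>A left-ordered group acting densely on the natural numbers\<close>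

text \<open>A countable \<Gamma> is at best dense in the symmetric group, so a single level would
  recover a structure only up to \<Gamma>. Infinitely many levels pass to the closure, provided that
  limits are confined to tuples: convergence of \<open>g n + h\<close> in a regular representation
  would force \<open>g n\<close> to be eventually constant, whereas on tuples it is pointwise
  convergence of \<open>act (g n)\<close>.

  A linear automorphism is not assumed to commute with anything. The graphs of the maps from
  \<open>Src h\<close> to \<open>shift h y\<close> tie its values together: the image
  \<open>u\<close> of \<open>Src 0\<close> determines the image of every \<open>y\<close> as
  \<open>u\<close> times \<open>y\<close>. No graph controls the other \<open>Src h\<close>, so the
  second copy \<open>Reg\<close> is where \<open>u\<close> and the element \<open>u'\<close> of the
  inverse automorphism multiply to 1.

  If \<open>u\<close> had several terms, a tuple could be sent to a mixture of tuples. Elements of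
  finite order would make zero divisors in \<rat>[\<Gamma>]; hence \<Gamma> consists of order
  automorphisms of the rationals rather than of permutations of \<omega>.\<close>

text \<open>
  Colour the rationals with \<open>\<omega>\<close> so that every colour is dense. By back-and-forth, every permutation
  of the colours is induced by an order automorphism of the rationals, and groups of order
  automorphisms are left-orderable.
\<close>

definition rat_colour :: "rat \<Rightarrow> nat"
  where "rat_colour x = (LEAST i. \<exists>k m. odd m \<and> x = of_int k / (2 ^ i * of_int m))"

text \<open>\<open>rat_colour\<close> is the exponent of 2 in the reduced denominator. A smaller
  exponent would equate the odd number \<open>k * m'\<close> with an even one.\<close>

lemma rat_colour_eq:
  assumes "odd k" "odd m"
  shows "rat_colour (of_int k / (2 ^ i * of_int m)) = i"
  unfolding rat_colour_def
proof (rule Least_equality)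
  show "\<exists>k' m'. odd m' \<and>
      (of_int k / (2 ^ i * of_int m) :: rat) = of_int k' / (2 ^ i * of_int m')"
    using assms by blast
next
  fix j
  assume "\<exists>k' m'. odd m' \<and>
      (of_int k / (2 ^ i * of_int m) :: rat) = of_int k' / (2 ^ j * of_int m')"
  then obtain k' m' where m': "odd m'"
    and eq: "(of_int k / (2 ^ i * of_int m) :: rat) = of_int k' / (2 ^ j * of_int m')"
    by blast
  show "i \<le> j"
  proof (rule ccontr)
    assume "\<not> i \<le> j"
    then obtain d where d: "i = j + Suc d"
      using less_imp_Suc_add by (metis add_Suc_right not_le)
    have nz: "(of_int m :: rat) \<noteq> 0" "(of_int m' :: rat) \<noteq> 0"
      using assms m' by auto
    have "(of_int k * of_int m' :: rat) = of_int k' * 2 ^ Suc d * of_int m"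
      using eq nz by (simp add: d power_add field_simps)
    then have "(of_int (k * m') :: rat) = of_int (k' * 2 ^ Suc d * m)"
      by simp
    then have "k * m' = k' * 2 ^ Suc d * m"
      using of_int_eq_iff by blast
    moreover have "odd (k * m')"
      using assms m' by simp
    ultimately show False by simp
  qed
qed

lemma rat_colour_dense:
  assumes "a < b"
  shows "\<exists>q. a < q \<and> q < b \<and> rat_colour q = i"
proof -
  obtain N :: nat where N: "3 / (b - a) < of_nat N"
    using reals_Archimedean2 by blast
  define m :: int where "m = 2 * int N + 1"
  define M :: rat where "M = 2 ^ i * of_int m"
  have m_pos: "m > 0" and m_ge: "(of_nat N :: rat) \<le> of_int m"
    by (simp_all add: m_def)
  have M_pos: "M > 0"
    unfolding M_def using m_pos by simp
  have "(of_int m :: rat) \<le> M"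
    unfolding M_def using m_pos by (simp add: mult_le_cancel_right1)
  then have "3 / (b - a) < M"
    using N m_ge by linarith
  then have large: "3 < b * M - a * M"
    using assms by (simp add: field_simps)
  \<comment> \<open>An odd integer with \<open>a * M < k\<close> and \<open>k <= a * M + 3\<close>;
    the choice of \<open>N\<close> made the interval from \<open>a * M\<close> to
    \<open>b * M\<close> longer than 3.\<close>
  define k where "k = 2 * \<lfloor>a * M / 2\<rfloor> + 3"
  have "a * M / 2 < of_int \<lfloor>a * M / 2\<rfloor> + 1" "of_int \<lfloor>a * M / 2\<rfloor> \<le> a * M / 2"
    by linarith+
  then have "a * M < of_int k" "of_int k < b * M"
    using large by (auto simp: k_def)
  then have "a < of_int k / M" "of_int k / M < b"
    using M_pos by (simp_all add: field_simps)
  moreover have "rat_colour (of_int k / M) = i"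
    unfolding M_def by (rule rat_colour_eq) (simp_all add: k_def m_def)
  ultimately show ?thesis by blast
qed

lemma rat_colour_between:
  assumes "finite L" "finite R" and less: "\<And>l r. l \<in> L \<Longrightarrow> r \<in> R \<Longrightarrow> l < r"
  shows "\<exists>q. (\<forall>l\<in>L. l < q) \<and> (\<forall>r\<in>R. q < r) \<and> rat_colour q = i"
proof -
  obtain a b :: rat where "a < b" "\<forall>l\<in>L. l \<le> a" "\<forall>r\<in>R. b \<le> r"
  proof (cases "L = {}"; cases "R = {}")
    assume "L = {}" "R = {}"
    then show thesis by (intro that[of 0 1]) auto
  next
    assume "L = {}" "R \<noteq> {}"
    then show thesis using assms(2) Min_le[of R]
      by (intro that[of "Min R - 1" "Min R"]) (simp_all del: Min_gr_iff Min_ge_iff)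
  next
    assume "L \<noteq> {}" "R = {}"
    then show thesis using assms(1) by (intro that[of "Max L" "Max L + 1"]) simp_all
  next
    assume "L \<noteq> {}" "R \<noteq> {}"
    then show thesis using assms by (intro that[of "Max L" "Min R"]) auto
  qed
  then show ?thesis
    using rat_colour_dense[of a b i] by (meson le_less_trans less_le_trans)
qed

text \<open>The order condition, applied to two pairs in both orders, also gives
  \<open>x = x'\<close> iff \<open>y = y'\<close>, so \<open>f\<close> is a finite injective partial
  function. This makes the notion pass to the converse, with \<sigma> inverted.\<close>

definition partial_lift :: "(nat \<Rightarrow> nat) \<Rightarrow> (rat \<times> rat) set \<Rightarrow> bool"
  where "partial_lift \<sigma> f \<longleftrightarrow> finite f \<and>
    (\<forall>(x, y)\<in>f. rat_colour y = \<sigma> (rat_colour x)) \<and>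
    (\<forall>(x, y)\<in>f. \<forall>(x', y')\<in>f. x < x' \<longleftrightarrow> y < y')"

lemma partial_lift_extend:
  assumes "partial_lift \<sigma> f"
  shows "\<exists>g y. partial_lift \<sigma> g \<and> f \<subseteq> g \<and> (x, y) \<in> g"
proof (cases "\<exists>y. (x, y) \<in> f")
  case True
  then show ?thesis using assms by blast
next
  case False
  define L where "L = snd ` {p \<in> f. fst p < x}"
  define R where "R = snd ` {p \<in> f. x < fst p}"
  have fin: "finite f" and col: "\<And>u v. (u, v) \<in> f \<Longrightarrow> rat_colour v = \<sigma> (rat_colour u)"
    and mono: "\<And>u v u' v'. (u, v) \<in> f \<Longrightarrow> (u', v') \<in> f \<Longrightarrow> u < u' \<longleftrightarrow> v < v'"
    using assms unfolding partial_lift_def by blast+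
  have "\<exists>q. (\<forall>l\<in>L. l < q) \<and> (\<forall>r\<in>R. q < r) \<and> rat_colour q = \<sigma> (rat_colour x)"
  proof (rule rat_colour_between)
    show "finite L" "finite R"
      unfolding L_def R_def using fin by auto
    show "l < r" if lr: "l \<in> L" "r \<in> R" for l r
    proof -
      obtain u u' where "(u, l) \<in> f" "u < x" "(u', r) \<in> f" "x < u'"
        using lr unfolding L_def R_def by auto
      then show ?thesis using mono[of u l u' r] by auto
    qed
  qed
  then obtain q where q: "\<forall>l\<in>L. l < q" "\<forall>r\<in>R. q < r" "rat_colour q = \<sigma> (rat_colour x)"
    by blast
  have new: "(u < x \<longleftrightarrow> v < q) \<and> (x < u \<longleftrightarrow> q < v)" if uv: "(u, v) \<in> f" for u v
  proof -
    have "u \<noteq> x" using False uv by blast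
    then consider "u < x" | "x < u" by force
    then show ?thesis
    proof cases
      case 1
      then have "v \<in> L" unfolding L_def using uv by force
      then show ?thesis using q 1 by force
    next
      case 2
      then have "v \<in> R" unfolding R_def using uv by force
      then show ?thesis using q 2 by force
    qed
  qed
  have "partial_lift \<sigma> (insert (x, q) f)"
    unfolding partial_lift_def using fin col mono q(3) new by auto
  then show ?thesis by blast
qed

lemma partial_lift_converse:
  assumes "partial_lift \<sigma> f" "bij \<sigma>"
  shows "partial_lift (inv_into UNIV \<sigma>) (f\<inverse>)"
  using assms unfolding partial_lift_def
  by (auto simp: bij_is_inj inv_f_f)

lemma partial_lift_extend_back:
  assumes "partial_lift \<sigma> f" "bij \<sigma>"
  shows "\<exists>g x. partial_lift \<sigma> g \<and> f \<subseteq> g \<and> (x, y) \<in> g"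
proof -
  obtain g x where "partial_lift (inv_into UNIV \<sigma>) g" "f\<inverse> \<subseteq> g" "(y, x) \<in> g"
    using partial_lift_extend[OF partial_lift_converse[OF assms]] by blast
  moreover have "partial_lift \<sigma> (g\<inverse>)"
    using partial_lift_converse[OF calculation(1) bij_imp_bij_inv[OF assms(2)]]
    by (simp add: inv_inv_eq assms(2))
  ultimately show ?thesis
    by (intro exI[of _ "g\<inverse>"] exI[of _ x]) auto
qed

definition lifts :: "(nat \<Rightarrow> nat) \<Rightarrow> (rat \<Rightarrow> rat) \<Rightarrow> bool"
  where "lifts \<sigma> h \<longleftrightarrow> bij \<sigma> \<and> bij h \<and> strict_mono h \<and> (\<forall>q. rat_colour (h q) = \<sigma> (rat_colour q))"

lemma lifts_exists:
  assumes "bij \<sigma>"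
  shows "\<exists>h. lifts \<sigma> h"
proof -
  \<comment> \<open>Stage \<open>n\<close> adds \<open>from_nat n\<close> first to the domain and
    then to the range, so the union is total and onto.\<close>
  have "\<exists>f. \<forall>n. partial_lift \<sigma> (f n) \<and> (f n \<subseteq> f (Suc n) \<and>
      (\<exists>y. (from_nat n, y) \<in> f (Suc n)) \<and> (\<exists>x. (x, from_nat n) \<in> f (Suc n)))"
  proof (rule dependent_nat_choice)
    show "\<exists>f. partial_lift \<sigma> f"
      by (rule exI[of _ "{}"]) (simp add: partial_lift_def)
  next
    fix f and n :: nat
    assume "partial_lift \<sigma> f"
    then obtain g y where g: "partial_lift \<sigma> g" "f \<subseteq> g" "(from_nat n, y) \<in> g"
      using partial_lift_extend by blast
    then obtain k x where "partial_lift \<sigma> k" "g \<subseteq> k" "(x, from_nat n) \<in> k"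
      using partial_lift_extend_back[OF g(1) assms] by blast
    then show "\<exists>k. partial_lift \<sigma> k \<and> (f \<subseteq> k \<and>
        (\<exists>y. (from_nat n, y) \<in> k) \<and> (\<exists>x. (x, from_nat n) \<in> k))"
      using g by blast
  qed
  then obtain f where f: "\<And>n. partial_lift \<sigma> (f n)" "\<And>n. f n \<subseteq> f (Suc n)"
    "\<And>n. \<exists>y. (from_nat n, y) \<in> f (Suc n)" "\<And>n. \<exists>x. (x, from_nat n) \<in> f (Suc n)"
    by blast
  define U where "U = (\<Union>n. f n)"
  have chain: "f m \<subseteq> f n" if "m \<le> n" for m n
    using lift_Suc_mono_le[of f, OF f(2) that] .
  have common: "\<exists>n. p \<in> f n \<and> p' \<in> f n" if pU: "p \<in> U" "p' \<in> U" for p p'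
  proof -
    obtain m n where "p \<in> f m" "p' \<in> f n" using pU unfolding U_def by blast
    then show ?thesis using chain[of m "max m n"] chain[of n "max m n"] by auto
  qed
  have order: "x < x' \<longleftrightarrow> y < y'" if "(x, y) \<in> U" "(x', y') \<in> U" for x y x' y'
    using common[OF that] f(1) unfolding partial_lift_def by blast
  have colour: "rat_colour y = \<sigma> (rat_colour x)" if "(x, y) \<in> U" for x y
    using common[OF that that] f(1) unfolding partial_lift_def by blast
  have total: "\<exists>y. (x, y) \<in> U" for x
    using f(3)[of "to_nat x"] unfolding U_def by auto
  have onto: "\<exists>x. (x, y) \<in> U" for y
    using f(4)[of "to_nat y"] unfolding U_def by auto
  obtain h where h: "\<And>x. (x, h x) \<in> U"
    using total by metis
  have "strict_mono h"
    using order[OF h h] by (simp add: strict_mono_def)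
  moreover have "surj h"
    unfolding surj_def
  proof
    fix y
    obtain x where "(x, y) \<in> U" using onto by blast
    then show "\<exists>x. y = h x"
      using order[OF h[of x] \<open>(x, y) \<in> U\<close>] order[OF \<open>(x, y) \<in> U\<close> h[of x]] by (intro exI[of _ x]) force
  qed
  ultimately have "lifts \<sigma> h"
    unfolding lifts_def using assms colour[OF h] strict_mono_imp_inj_on by (auto simp: bij_def)
  then show ?thesis by blast
qed

lemma lifts_id: "lifts id id"
  by (simp add: lifts_def strict_mono_def)

lemma lifts_comp: "lifts \<sigma> h \<Longrightarrow> lifts \<tau> k \<Longrightarrow> lifts (\<sigma> \<circ> \<tau>) (h \<circ> k)"
  by (auto simp: lifts_def bij_comp strict_mono_def)

lemma lifts_inv:
  assumes "lifts \<sigma> h"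
  shows "lifts (inv_into UNIV \<sigma>) (inv_into UNIV h)"
proof -
  have bij: "bij \<sigma>" "bij h" and mono: "strict_mono h"
    and col: "\<And>q. rat_colour (h q) = \<sigma> (rat_colour q)"
    using assms by (auto simp: lifts_def)
  have "strict_mono (inv_into UNIV h)"
    using bij(2) mono by (metis bij_inv_eq_iff strict_mono_def strict_mono_less)
  moreover have "rat_colour (inv_into UNIV h q) = inv_into UNIV \<sigma> (rat_colour q)" for q
    using bij col[of "inv_into UNIV h q"] by (simp add: bij_is_surj surj_f_inv_f bij_inv_eq_iff)
  ultimately show ?thesis
    by (simp add: lifts_def bij bij_imp_bij_inv)
qed

text \<open>
  One generator for each list suffices for density: it induces a permutation of the colours that
  begins with the list, whenever some permutation does.
\<close>

definition gen :: "nat list \<Rightarrow> rat \<Rightarrow> rat"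
  where "gen xs = (SOME h. \<exists>\<sigma>. lifts \<sigma> h \<and> ((\<exists>\<tau>. bij \<tau> \<and> map \<tau> [0..<length xs] = xs) \<longrightarrow> map \<sigma> [0..<length xs] = xs))"

lemma gen_lifts:
  "\<exists>\<sigma>. lifts \<sigma> (gen xs) \<and> ((\<exists>\<tau>. bij \<tau> \<and> map \<tau> [0..<length xs] = xs) \<longrightarrow> map \<sigma> [0..<length xs] = xs)"
proof -
  have "\<exists>h \<sigma>. lifts \<sigma> h \<and> ((\<exists>\<tau>. bij \<tau> \<and> map \<tau> [0..<length xs] = xs) \<longrightarrow> map \<sigma> [0..<length xs] = xs)"
    using lifts_exists lifts_id by blast
  then show ?thesis
    unfolding gen_def by (rule someI_ex)
qed

section \<open>The countable group generated by the lifts\<close>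

primrec word :: "(nat list \<times> bool) list \<Rightarrow> rat \<Rightarrow> rat"
  where "word [] = id"
  | "word (w # ws) = (if snd w then gen (fst w) else inv_into UNIV (gen (fst w))) \<circ> word ws"

lemma word_append: "word (us @ ws) = word us \<circ> word ws"
  by (induction us) (simp_all add: comp_assoc)

lemma word_lifts: "\<exists>\<sigma>. lifts \<sigma> (word ws)"
proof (induction ws)
  case Nil
  then show ?case using lifts_id by (metis word.simps(1))
next
  case (Cons w ws)
  obtain \<sigma> where "lifts \<sigma> (gen (fst w))" using gen_lifts by blast
  then have "\<exists>\<sigma>. lifts \<sigma> (if snd w then gen (fst w) else inv_into UNIV (gen (fst w)))"
    using lifts_inv by auto
  then show ?case using Cons lifts_comp by (metis word.simps(2))
qed

lemma bij_gen: "bij (gen xs)" and bij_word: "bij (word ws)"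
  using gen_lifts word_lifts lifts_def by blast+

lemma word_inverse: "word (rev (map (apsnd Not) ws)) = inv_into UNIV (word ws)"
proof (induction ws)
  case (Cons w ws)
  define k where "k = (if snd w then gen (fst w) else inv_into UNIV (gen (fst w)))"
  have "bij k" and k_inv: "(if snd w then inv_into UNIV (gen (fst w)) else gen (fst w)) = inv_into UNIV k"
    unfolding k_def by (simp_all add: bij_gen bij_imp_bij_inv inv_inv_eq)
  have "word (rev (map (apsnd Not) (w # ws))) = inv_into UNIV (word ws) \<circ> inv_into UNIV k"
    using Cons k_inv by (cases "snd w") (simp_all add: word_append)
  also have "\<dots> = inv_into UNIV (word (w # ws))"
    using o_inv_distrib[OF \<open>bij k\<close> bij_word] by (simp add: k_def)
  finally show ?case .
qed simp

text \<open>Words in the countably many \<open>gen xs\<close> give a countable group; taking all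
  order automorphisms that lift permutations would not. The group is written additively,
  \<open>group_add\<close> being the class of groups without commutativity.\<close>

typedef gam = "range word"
  morphisms app Gam by blast

setup_lifting type_definition_gam

instantiation gam :: group_add
begin

lift_definition zero_gam :: gam is id
  by (rule range_eqI[of _ _ "[]"]) simp

lift_definition plus_gam :: "gam \<Rightarrow> gam \<Rightarrow> gam" is "(\<circ>)"
  by (auto simp: word_append[symmetric])

lift_definition uminus_gam :: "gam \<Rightarrow> gam" is "inv_into UNIV"
  by (auto simp: word_inverse[symmetric])

definition minus_gam :: "gam \<Rightarrow> gam \<Rightarrow> gam"
  where "minus_gam g h = g + - h"

instance
proof
  fix a b c :: gam
  show "a + b + c = a + (b + c)" by transfer (simp add: comp_assoc)
  show "0 + a = a" "a + 0 = a" by (transfer; simp)+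
  show "- a + a = 0" by transfer (use bij_word in \<open>auto simp: bij_is_inj\<close>)
  show "a + - b = a - b" by (simp add: minus_gam_def)
qed

end

instance gam :: countable
proof
  have "countable (range app)"
    using type_definition.Rep_range[OF type_definition_gam] by simp
  then obtain f :: "(rat \<Rightarrow> rat) \<Rightarrow> nat" where "inj_on f (range app)"
    by (auto simp: countable_def)
  then have "inj (f \<circ> app)"
    using app_inject by (auto simp: inj_on_def)
  then show "\<exists>f :: gam \<Rightarrow> nat. inj f" by blast
qed

lemma app_lifts: "\<exists>\<sigma>. lifts \<sigma> (app g)"
  using app[of g] word_lifts by auto

lemma app_add: "app (g + h) q = app g (app h q)"
  by (simp add: plus_gam.rep_eq)

lemma strict_mono_app: "strict_mono (app g)"
  using app_lifts lifts_def by blast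

instantiation gam :: linorder
begin

text \<open>Comparing at the first rational where two automorphisms differ makes the order left invariant.\<close>

definition less_gam :: "gam \<Rightarrow> gam \<Rightarrow> bool"
  where "g < h \<longleftrightarrow> (\<exists>k. (\<forall>j<k. app g (from_nat j) = app h (from_nat j)) \<and>
    app g (from_nat k) < app h (from_nat k))"

definition less_eq_gam :: "gam \<Rightarrow> gam \<Rightarrow> bool"
  where "g \<le> h \<longleftrightarrow> g < h \<or> g = (h :: gam)"

instance
proof
  have trans: "x < z" if xyz: "x < y" "y < z" for x y z :: gam
  proof -
    obtain k l where
      k: "\<And>j. j < k \<Longrightarrow> app x (from_nat j) = app y (from_nat j)" "app x (from_nat k) < app y (from_nat k)" and
      l: "\<And>j. j < l \<Longrightarrow> app y (from_nat j) = app z (from_nat j)" "app y (from_nat l) < app z (from_nat l)"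
      using xyz unfolding less_gam_def by blast
    have "app x (from_nat (min k l)) < app z (from_nat (min k l))"
      using k l by (metis less_trans linorder_neqE_nat min.absorb3 min.absorb4 min.idem)
    then show ?thesis
      unfolding less_gam_def using k(1) l(1) by (metis min_less_iff_conj)
  qed
  have irrefl: "\<not> x < x" for x :: gam
    by (auto simp: less_gam_def)
  fix x y z :: gam
  show "x < y \<longleftrightarrow> x \<le> y \<and> \<not> y \<le> x"
    unfolding less_eq_gam_def using trans[of x y] trans[of x y x] irrefl[of x] by blast
  show "x \<le> x" by (simp add: less_eq_gam_def)
  show "x \<le> y \<Longrightarrow> y \<le> z \<Longrightarrow> x \<le> z"
    unfolding less_eq_gam_def using trans by blast
  show "x \<le> y \<Longrightarrow> y \<le> x \<Longrightarrow> x = y"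
    unfolding less_eq_gam_def using trans[of x y x] irrefl[of x] by auto
  show "x \<le> y \<or> y \<le> x"
  proof (cases "x = y")
    case False
    then have "\<exists>q. app x q \<noteq> app y q"
      by (metis app_inject ext)
    then have ex: "\<exists>k. app x (from_nat k) \<noteq> app y (from_nat k)"
      by (metis from_nat_to_nat)
    define k where "k = (LEAST k. app x (from_nat k) \<noteq> app y (from_nat k))"
    have "app x (from_nat k) \<noteq> app y (from_nat k)"
      "\<forall>j<k. app x (from_nat j) = app y (from_nat j)"
      unfolding k_def using LeastI_ex[OF ex] not_less_Least by blast+
    then show ?thesis
      unfolding less_eq_gam_def less_gam_def by (metis linorder_neqE)
  qed (simp add: less_eq_gam_def)
qed

end

lemma gam_add_strict_left_mono: "g < h \<Longrightarrow> f + g < f + (h :: gam)"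
  unfolding less_gam_def app_add using strict_mono_less[OF strict_mono_app[of f]] by metis

definition act :: "gam \<Rightarrow> nat \<Rightarrow> nat"
  where "act g = (THE \<sigma>. lifts \<sigma> (app g))"

text \<open>Every colour is the colour of some rational, so a map of the rationals lifts at most one
  permutation.\<close>

lemma lifts_act: "lifts (act g) (app g)"
proof -
  have "\<sigma> = \<tau>" if "lifts \<sigma> (app g)" "lifts \<tau> (app g)" for \<sigma> \<tau>
    using that rat_colour_dense[of 0 1] unfolding lifts_def by (metis ext zero_less_one)
  then show ?thesis
    unfolding act_def using app_lifts by (metis theI)
qed

lemma lifts_unique: "lifts \<sigma> (app g) \<Longrightarrow> act g = \<sigma>"
  using lifts_act[of g] rat_colour_dense[of 0 1] unfolding lifts_def by (metis ext zero_less_one)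

lemma act_add: "act (g + h) = act g \<circ> act h"
  by (rule lifts_unique) (simp add: plus_gam.rep_eq lifts_comp lifts_act)

lemma act_zero: "act 0 = id"
  by (rule lifts_unique) (simp add: zero_gam.rep_eq lifts_id)

lemma bij_act: "bij (act g)"
  using lifts_act lifts_def by blast

lemma act_dense:
  assumes "bij \<sigma>"
  shows "\<exists>g. \<forall>i<n. act g i = \<sigma> i"
proof -
  obtain \<tau> where \<tau>: "lifts \<tau> (gen (map \<sigma> [0..<n]))" "map \<tau> [0..<n] = map \<sigma> [0..<n]"
    using gen_lifts[of "map \<sigma> [0..<n]"] assms by auto
  have "word [(map \<sigma> [0..<n], True)] = gen (map \<sigma> [0..<n])"
    by simp
  then have "app (Gam (gen (map \<sigma> [0..<n]))) = gen (map \<sigma> [0..<n])"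
    by (metis Gam_inverse rangeI)
  then have "act (Gam (gen (map \<sigma> [0..<n]))) = \<tau>"
    using \<tau>(1) lifts_unique by metis
  then show ?thesis
    using \<tau>(2) by (intro exI[of _ "Gam (gen (map \<sigma> [0..<n]))"]) simp
qed

section \<open>Units of the group ring of a left-ordered group\<close>

text \<open>
  Only left invariance is available, so the largest element of a product of supports need not be
  the product of the largest elements; but its right factor is the largest one, which still makes
  the factorisation unique. The same holds for the smallest element.
\<close>

lemma trivial_unit:
  fixes u u' :: "'g :: {group_add, linorder} \<Rightarrow> 'k :: idom"
  assumes mono: "\<And>a b c :: 'g. b < c \<Longrightarrow> a + b < a + c"
    and fin: "finite {g. u g \<noteq> 0}" "finite {g. u' g \<noteq> 0}"
    and unit: "\<And>h. (\<Sum>g | u' g \<noteq> 0. u (h - g) * u' g) = (if h = 0 then 1 else 0)"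
  shows "\<exists>g c. c \<noteq> 0 \<and> (\<forall>h. u h = (if h = g then c else 0))"
proof -
  define A where "A = {g. u g \<noteq> 0}"
  define B where "B = {g. u' g \<noteq> 0}"
  have finA: "finite A" and finB: "finite B"
    using fin by (simp_all add: A_def B_def)
  have ne: "A \<noteq> {}" "B \<noteq> {}"
  proof -
    show "A \<noteq> {}"
    proof
      assume "A = {}"
      then have "u g = 0" for g unfolding A_def by auto
      then show False using unit[of 0] by simp
    qed
    show "B \<noteq> {}"
    proof
      assume "B = {}"
      then show False using unit[of 0] by (simp add: B_def)
    qed
  qed
  \<comment> \<open>If the right factor of \<open>x + y\<close> is forced, so is the left one, and
    the coefficient of the product at \<open>x + y\<close> is the single nonzero term
    \<open>u x * u' y\<close>. The product has no nonzero coefficient except at 0.\<close>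
  have extreme: "x + y = 0"
    if xy: "x \<in> A" "y \<in> B" and unique: "\<And>a b. a \<in> A \<Longrightarrow> b \<in> B \<Longrightarrow> a + b = x + y \<Longrightarrow> b = y" for x y
  proof (rule ccontr)
    assume nz: "x + y \<noteq> 0"
    have "(\<Sum>g | u' g \<noteq> 0. u (x + y - g) * u' g) = (\<Sum>g\<in>B. if g = y then u x * u' y else 0)"
      unfolding B_def[symmetric]
    proof (rule sum.cong)
      fix g assume g: "g \<in> B"
      show "u (x + y - g) * u' g = (if g = y then u x * u' y else 0)"
      proof (cases "g = y")
        case False
        then have "x + y - g \<notin> A"
          using unique[OF _ g, of "x + y - g"] by (auto simp: algebra_simps)
        then show ?thesis using False by (simp add: A_def)
      qed simp
    qed simp
    also have "\<dots> = u x * u' y"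
      using finB xy by simp
    also have "\<dots> \<noteq> 0"
      using xy by (simp add: A_def B_def)
    finally show False using unit[of "x + y"] nz by simp
  qed
  define P where "P = (\<lambda>(a, b). a + b) ` (A \<times> B)"
  have finP: "finite P" and neP: "P \<noteq> {}"
    unfolding P_def using finA finB ne by auto
  have "Max P = 0"
  proof -
    obtain x y where xy: "x \<in> A" "y \<in> B" "Max P = x + y"
      using Max_in[OF finP neP] unfolding P_def by auto
    have "b = y" if ab: "a \<in> A" "b \<in> B" "a + b = x + y" for a b
    proof -
      have top: "c = Max B" if "d \<in> A" "c \<in> B" "d + c = Max P" for d c
      proof (rule ccontr)
        assume "c \<noteq> Max B"
        then have "d + c < d + Max B"
          using mono Max_ge[OF finB that(2)] by auto
        moreover have "d + Max B \<in> P"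
          unfolding P_def using that Max_in[OF finB ne(2)] by auto
        ultimately show False
          using Max_ge[OF finP] that(3) by (metis not_less)
      qed
      then show ?thesis using ab xy by metis
    qed
    then show ?thesis using extreme[OF xy(1,2)] xy(3) by metis
  qed
  moreover have "Min P = 0"
  proof -
    obtain x y where xy: "x \<in> A" "y \<in> B" "Min P = x + y"
      using Min_in[OF finP neP] unfolding P_def by auto
    have "b = y" if ab: "a \<in> A" "b \<in> B" "a + b = x + y" for a b
    proof -
      have bot: "c = Min B" if "d \<in> A" "c \<in> B" "d + c = Min P" for d c
      proof (rule ccontr)
        assume "c \<noteq> Min B"
        then have "d + Min B < d + c"
          using mono Min_le[OF finB that(2)] by auto
        moreover have "d + Min B \<in> P"
          unfolding P_def using that Min_in[OF finB ne(2)] by auto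
        ultimately show False
          using Min_le[OF finP] that(3) by (metis not_less)
      qed
      then show ?thesis using ab xy by metis
    qed
    then show ?thesis using extreme[OF xy(1,2)] xy(3) by metis
  qed
  \<comment> \<open>With the least and the greatest sum equal to 0, every sum is 0; cancelling a
    fixed right summand then leaves a single element in \<open>A\<close>.\<close>
  ultimately have all_zero: "a + b = 0" if "a \<in> A" "b \<in> B" for a b
  proof -
    have "a + b \<in> P" unfolding P_def using that by auto
    then show ?thesis
      using Max_ge[OF finP] Min_le[OF finP] \<open>Max P = 0\<close> \<open>Min P = 0\<close> by (metis antisym)
  qed
  obtain x y where xy: "x \<in> A" "y \<in> B" using ne by blast
  have "a = x" if "a \<in> A" for a
    using all_zero[OF that xy(2)] all_zero[OF xy] by (metis add_right_cancel)
  then have "A \<subseteq> {x}"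
    by blast
  then have "u h = (if h = x then u x else 0)" for h
    unfolding A_def by (cases "u h = 0") auto
  moreover have "u x \<noteq> 0"
    using xy by (simp add: A_def)
  ultimately show ?thesis by blast
qed

section \<open>Eventually constant sequences and their distinguished subspaces\<close>

text \<open>
  \<open>Src\<close> indexes the regular representation on which units are read off, \<open>Reg\<close> a second copy of
  it, and \<open>Tup\<close> the tagged tuples.
\<close>

datatype idx = is_Src: Src gam | Reg gam | is_Tup: Tup nat "nat list"

instance idx :: countable
  by countable_datatype

primrec shift :: "gam \<Rightarrow> idx \<Rightarrow> idx"
  where "shift g (Src h) = Src (g + h)"
  | "shift g (Reg h) = Reg (g + h)"
  | "shift g (Tup t xs) = Tup t (map (act g) xs)"

lemma shift_add: "shift (g + h) z = shift g (shift h z)"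
  by (cases z) (simp_all add: add.assoc act_add)

lemma shift_zero [simp]: "shift 0 z = z"
  by (cases z) (simp_all add: act_zero)

lemma shift_minus [simp]: "shift (- g) (shift g z) = z" "shift g (shift (- g) z) = z"
  by (simp_all add: shift_add[symmetric])

lemma is_Src_shift [simp]: "is_Src (shift g z) \<longleftrightarrow> is_Src z"
  by (cases z) simp_all

type_synonym level_vec = "nat \<Rightarrow> idx \<Rightarrow> rat"

definition vecs :: "level_vec set"
  where "vecs = {v. (\<forall>n. finite {z. v n z \<noteq> 0}) \<and>
    (\<exists>l. (\<forall>\<^sub>F n in sequentially. v n = l) \<and> (\<forall>z. l z \<noteq> 0 \<longrightarrow> is_Tup z))}"

definition limit :: "level_vec \<Rightarrow> idx \<Rightarrow> rat"
  where "limit v = (THE l. \<forall>\<^sub>F n in sequentially. v n = l)"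

definition scale :: "rat \<Rightarrow> level_vec \<Rightarrow> level_vec"
  where "scale q v = (\<lambda>n z. q * v n z)"

definition unit_vec :: "nat \<Rightarrow> idx \<Rightarrow> level_vec"
  where "unit_vec n z = (\<lambda>m w. if m = n \<and> w = z then 1 else 0)"

definition const_vec :: "idx \<Rightarrow> level_vec"
  where "const_vec z = (\<lambda>m w. if w = z then 1 else 0)"

lemma limit_eqI: "\<forall>\<^sub>F n in sequentially. v n = l \<Longrightarrow> limit v = l"
  unfolding limit_def
proof (rule the_equality)
  fix l' assume "\<forall>\<^sub>F n in sequentially. v n = l" "\<forall>\<^sub>F n in sequentially. v n = l'"
  then have "\<forall>\<^sub>F n in sequentially. l' = l" by eventually_elim simp
  then show "l' = l" by simp
qed

lemma vecsI:
  assumes "\<And>n. finite {z. v n z \<noteq> 0}" "\<forall>\<^sub>F n in sequentially. v n = l" "\<And>z. l z \<noteq> 0 \<Longrightarrow> is_Tup z"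
  shows "v \<in> vecs"
  using assms unfolding vecs_def by blast

lemma finite_support: "v \<in> vecs \<Longrightarrow> finite {z. v n z \<noteq> 0}"
  by (simp add: vecs_def)

lemma eventually_limit: "v \<in> vecs \<Longrightarrow> \<forall>\<^sub>F n in sequentially. v n = limit v"
  using limit_eqI unfolding vecs_def by blast

lemma is_Tup_limit: "v \<in> vecs \<Longrightarrow> limit v z \<noteq> 0 \<Longrightarrow> is_Tup z"
  using limit_eqI unfolding vecs_def by blast

lemma finite_support_limit:
  assumes "v \<in> vecs"
  shows "finite {z. limit v z \<noteq> 0}"
proof -
  obtain n where "v n = limit v"
    using eventually_limit[OF assms] by (meson eventually_happens' sequentially_bot)
  then show ?thesis using finite_support[OF assms, of n] by simp
qed

lemma limit_add:
  assumes "v \<in> vecs" "w \<in> vecs"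
  shows "limit (v + w) = limit v + limit w"
  by (rule limit_eqI, use eventually_limit[OF assms(1)] eventually_limit[OF assms(2)] in eventually_elim) simp

lemma limit_scale:
  assumes "v \<in> vecs"
  shows "limit (scale q v) = (\<lambda>z. q * limit v z)"
  by (rule limit_eqI, use eventually_limit[OF assms(1)] in eventually_elim) (simp add: scale_def)

lemma vecs_zero: "0 \<in> vecs"
  by (rule vecsI[of _ "\<lambda>_. 0"]) (auto simp: fun_eq_iff)

lemma vecs_add:
  assumes "v \<in> vecs" "w \<in> vecs"
  shows "v + w \<in> vecs"
proof (rule vecsI)
  show "finite {z. (v + w) n z \<noteq> 0}" for n
    by (rule finite_subset[OF _ finite_UnI[OF finite_support[OF assms(1), of n] finite_support[OF assms(2), of n]]])
      auto
  show "\<forall>\<^sub>F n in sequentially. (v + w) n = limit v + limit w"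
    using eventually_limit[OF assms(1)] eventually_limit[OF assms(2)] by eventually_elim simp
  show "is_Tup z" if "(limit v + limit w) z \<noteq> 0" for z
    using that is_Tup_limit[OF assms(1), of z] is_Tup_limit[OF assms(2), of z]
    by (cases "limit v z = 0") auto
qed

lemma vecs_scale:
  assumes "v \<in> vecs"
  shows "scale q v \<in> vecs"
proof (rule vecsI)
  show "finite {z. scale q v n z \<noteq> 0}" for n
    by (rule finite_subset[OF _ finite_support[OF assms, of n]]) (auto simp: scale_def)
  show "\<forall>\<^sub>F n in sequentially. scale q v n = (\<lambda>z. q * limit v z)"
    using eventually_limit[OF assms] by eventually_elim (simp add: scale_def)
  show "is_Tup z" if "q * limit v z \<noteq> 0" for z
    using that is_Tup_limit[OF assms, of z] by auto
qed

lemma scale_apply: "scale q v n z = q * v n z"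
  by (simp add: scale_def)

lemma scale_scale [simp]: "scale p (scale q v) = scale (p * q) v"
  by (simp add: scale_def mult.assoc)

lemma scale_one [simp]: "scale 1 v = v"
  by (simp add: scale_def)

lemma scale_zero [simp]: "scale 0 v = 0"
  by (simp add: scale_def fun_eq_iff)

lemma scale_add: "scale q (v + w) = scale q v + scale q w"
  by (simp add: scale_def fun_eq_iff algebra_simps)

lemma scale_add_left: "scale (p + q) v = scale p v + scale q v"
  by (simp add: scale_def fun_eq_iff algebra_simps)

lemma scale_minus_one: "scale (- 1) v = - v"
  by (simp add: scale_def fun_eq_iff)

lemma unit_vec_vecs: "unit_vec n z \<in> vecs"
proof (rule vecsI[of _ "\<lambda>_. 0"])
  show "finite {w. unit_vec n z m w \<noteq> 0}" for m
    by (rule finite_subset[of _ "{z}"]) (auto simp: unit_vec_def)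
  show "\<forall>\<^sub>F m in sequentially. unit_vec n z m = (\<lambda>_. 0)"
    using eventually_gt_at_top[of n] by eventually_elim (auto simp: unit_vec_def)
qed simp

lemma const_vec_vecs: "const_vec (Tup t xs) \<in> vecs"
proof (rule vecsI[of _ "\<lambda>w. if w = Tup t xs then 1 else 0"])
  show "finite {w. const_vec (Tup t xs) m w \<noteq> 0}" for m
    by (rule finite_subset[of _ "{Tup t xs}"]) (auto simp: const_vec_def)
qed (auto simp: const_vec_def split: if_splits)

lemma limit_const_vec: "limit (const_vec z) = (\<lambda>w. if w = z then 1 else 0)"
  by (rule limit_eqI) (simp add: const_vec_def)

text \<open>The coefficient of \<open>z\<close> in the image of \<open>f\<close> under the map \<open>Src h \<mapsto> h \<cdot> y\<close>.\<close>

definition src_sum :: "(idx \<Rightarrow> rat) \<Rightarrow> idx \<Rightarrow> idx \<Rightarrow> rat"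
  where "src_sum f y z = (\<Sum>h | f (Src h) \<noteq> 0 \<and> shift h y = z. f (Src h))"

lemma src_sum_eq:
  assumes "finite H" "{h. f (Src h) \<noteq> 0} \<subseteq> H"
  shows "src_sum f y z = (\<Sum>h\<in>H. if shift h y = z then f (Src h) else 0)"
  unfolding src_sum_def
  by (rule sum.mono_neutral_cong_left) (use assms in auto)

lemma finite_src_support: "v \<in> vecs \<Longrightarrow> finite {h. v n (Src h) \<noteq> 0}"
  using finite_vimageI[OF finite_support[of v n], of Src] by (simp add: inj_on_def vimage_def)

lemma src_sum_add:
  assumes "finite {h. f (Src h) \<noteq> 0}" "finite {h. g (Src h) \<noteq> 0}"
  shows "src_sum (f + g) y z = src_sum f y z + src_sum g y z"
proof -
  define H where "H = {h. f (Src h) \<noteq> 0} \<union> {h. g (Src h) \<noteq> 0}"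
  have "finite H" unfolding H_def using assms by blast
  then show ?thesis
    by (subst (1 2 3) src_sum_eq[of H]) (auto simp: H_def sum.distrib[symmetric] intro!: sum.cong)
qed

lemma src_sum_scale:
  assumes "finite {h. f (Src h) \<noteq> 0}"
  shows "src_sum (\<lambda>z. q * f z) y z = q * src_sum f y z"
  by (subst (1 2) src_sum_eq[OF assms]) (auto simp: sum_distrib_left intro!: sum.cong)

text \<open>
  Each key names a subspace, given by the functionals that vanish on it: the \<open>Src\<close> part and the
  remaining part of the level \<open>n\<close>, the sequences vanishing at the level \<open>n\<close>, the graph of the map
  \<open>Src h \<mapsto> h \<cdot> y\<close> at the level \<open>n\<close>, and the sequences with limit supported in \<open>S\<close>.
\<close>

datatype key = KSrc nat | KTgt nat | KNull nat | KMap nat idx | KSet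

instance key :: countable
  by countable_datatype

fun functionals :: "(nat \<times> nat list) set \<Rightarrow> key \<Rightarrow> (level_vec \<Rightarrow> rat) set"
  where "functionals S (KSrc n) = {\<lambda>v. v m z | m z. m \<noteq> n \<or> \<not> is_Src z}"
  | "functionals S (KTgt n) = {\<lambda>v. v m z | m z. m \<noteq> n \<or> is_Src z}"
  | "functionals S (KNull n) = {\<lambda>v. v n z | z. True}"
  | "functionals S (KMap n y) = {\<lambda>v. v m z | m z. m \<noteq> n} \<union>
      {\<lambda>v. v n z - src_sum (v n) y z | z. \<not> is_Src z}"
  | "functionals S KSet = {\<lambda>v. limit v (Tup t xs) | t xs. (t, xs) \<notin> S}"

lemma functional_add:
  assumes "l \<in> functionals S k" "v \<in> vecs" "w \<in> vecs"
  shows "l (v + w) = l v + l w"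
proof (cases k)
  case (KMap n y)
  have "src_sum ((v + w) n) y z = src_sum (v n) y z + src_sum (w n) y z" for z
    using src_sum_add[OF finite_src_support finite_src_support, OF assms(2,3)] by simp
  then show ?thesis using assms(1) KMap by auto
qed (use assms limit_add[OF assms(2,3)] in auto)

lemma functional_scale:
  assumes "l \<in> functionals S k" "v \<in> vecs"
  shows "l (scale q v) = q * l v"
proof (cases k)
  case (KMap n y)
  have "src_sum (scale q v n) y z = q * src_sum (v n) y z" for z
    unfolding scale_def by (rule src_sum_scale[OF finite_src_support[OF assms(2)]])
  then show ?thesis using assms(1) KMap by (auto simp: scale_apply right_diff_distrib)
qed (use assms limit_scale[OF assms(2)] in \<open>auto simp: scale_apply\<close>)

text \<open>All functionals have integer coefficients, which puts every integer-valued vector into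
  the group, whatever \<open>S\<close> is.\<close>

lemma functional_Ints:
  assumes "l \<in> functionals S k" "v \<in> vecs" and int: "\<And>n z. v n z \<in> \<int>"
  shows "l v \<in> \<int>"
proof -
  have lim: "limit v z \<in> \<int>" for z
  proof -
    obtain n where "v n = limit v"
      using eventually_limit[OF assms(2)] by (meson eventually_happens' sequentially_bot)
    then show ?thesis using int[of n z] by simp
  qed
  have "src_sum (v n) y z \<in> \<int>" for n y z
    unfolding src_sum_def using int by (intro Ints_sum)
  then have "v n z - src_sum (v n) y z \<in> \<int>" for n y z
    using int by (intro Ints_diff)
  moreover have "(\<exists>n z. l = (\<lambda>v. v n z)) \<or> (\<exists>n y z. l = (\<lambda>v. v n z - src_sum (v n) y z)) \<or>
      (\<exists>z. l = (\<lambda>v. limit v z))"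
    using assms(1) by (cases k) auto
  ultimately show ?thesis
    using int lim by (elim disjE exE) simp_all
qed

definition prime_of :: "key \<Rightarrow> nat"
  where "prime_of k = enumerate {p. prime p} (to_nat k)"

lemma prime_prime_of: "prime (prime_of k)"
  using enumerate_in_set[OF primes_infinite, of "to_nat k"] by (simp add: prime_of_def)

lemma prime_of_eq_iff: "prime_of k = prime_of k' \<longleftrightarrow> k = k'"
  unfolding prime_of_def
  using strict_mono_eq[OF strict_mono_enumerate[OF primes_infinite]] by simp

section \<open>The integers localised at a prime\<close>

definition local_ints :: "nat \<Rightarrow> rat set"
  where "local_ints p = {of_int a / of_int b | a b. \<not> int p dvd b}"

lemma local_ints_Ints:
  assumes "prime p" "x \<in> \<int>"
  shows "x \<in> local_ints p"
proof -
  obtain a where "x = of_int a / of_int 1"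
    using assms(2) by (auto elim: Ints_cases)
  moreover have "\<not> int p dvd 1"
    using prime_gt_1_nat[OF assms(1)] by simp
  ultimately show ?thesis unfolding local_ints_def by blast
qed

lemma local_ints_add:
  assumes "prime p" "x \<in> local_ints p" "y \<in> local_ints p"
  shows "x + y \<in> local_ints p"
proof -
  obtain a b c d where *: "x = of_int a / of_int b" "\<not> int p dvd b" "y = of_int c / of_int d" "\<not> int p dvd d"
    using assms unfolding local_ints_def by blast
  then have "b \<noteq> 0" "d \<noteq> 0" by auto
  then have "x + y = of_int (a * d + c * b) / of_int (b * d)"
    using * by (simp add: field_simps)
  moreover have "\<not> int p dvd b * d"
    using * assms(1) by (simp add: prime_dvd_mult_iff)
  ultimately show ?thesis unfolding local_ints_def by blast
qed

lemma local_ints_mult: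
  assumes "prime p" "x \<in> local_ints p" "y \<in> local_ints p"
  shows "x * y \<in> local_ints p"
proof -
  obtain a b c d where *: "x = of_int a / of_int b" "\<not> int p dvd b" "y = of_int c / of_int d" "\<not> int p dvd d"
    using assms unfolding local_ints_def by blast
  then have "x * y = of_int (a * c) / of_int (b * d)"
    by simp
  moreover have "\<not> int p dvd b * d"
    using * assms(1) by (simp add: prime_dvd_mult_iff)
  ultimately show ?thesis unfolding local_ints_def by blast
qed

lemma local_ints_inverse_power:
  assumes "prime p" "prime q" "p \<noteq> q"
  shows "1 / of_nat q ^ m \<in> local_ints p"
proof -
  have "\<not> p dvd q ^ m"
    using assms primes_dvd_imp_eq prime_dvd_power by blast
  then have "\<not> int p dvd int (q ^ m)"
    by (simp only: int_dvd_int_iff not_False_eq_True)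
  then show ?thesis
    unfolding local_ints_def
    by (intro CollectI exI[of _ 1] exI[of _ "int (q ^ m)"]) simp
qed

lemma local_ints_power_dvd_zero:
  assumes "prime p" and all: "\<And>m. x / of_nat p ^ m \<in> local_ints p"
  shows "x = 0"
proof (rule ccontr)
  assume "x \<noteq> 0"
  obtain a b where ab: "x = of_int a / of_int b" "\<not> int p dvd b"
    using all[of 0] unfolding local_ints_def by auto
  then have "a \<noteq> 0" "b \<noteq> 0" using \<open>x \<noteq> 0\<close> by auto
  have "int p ^ m dvd a" for m
  proof -
    obtain c d where cd: "x / of_nat p ^ m = of_int c / of_int d" "\<not> int p dvd d"
      using all[of m] unfolding local_ints_def by blast
    have "d \<noteq> 0" using cd by auto
    have "p > 0" using assms(1) prime_gt_0_nat by blast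
    have "(of_int (a * d) :: rat) = of_int (c * int p ^ m * b)"
      using cd(1) ab(1) \<open>b \<noteq> 0\<close> \<open>d \<noteq> 0\<close> \<open>p > 0\<close> by (simp add: field_simps)
    then have "a * d = c * int p ^ m * b"
      using of_int_eq_iff by blast
    then have "int p ^ m dvd a * d" by simp
    moreover have "coprime (int p ^ m) d"
      using cd(2) assms(1) by (simp add: prime_imp_coprime)
    ultimately show ?thesis
      using coprime_dvd_mult_left_iff by blast
  qed
  \<comment> \<open>The exponent \<open>nat |a|\<close> suffices because \<open>p ^ n > n\<close>,
    while a divisor of the nonzero \<open>a\<close> is at most \<open>|a|\<close>.\<close>
  then have "int p ^ nat \<bar>a\<bar> \<le> \<bar>a\<bar>"
    using \<open>a \<noteq> 0\<close> by (intro zdvd_imp_le) auto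
  moreover have "nat \<bar>a\<bar> < p ^ nat \<bar>a\<bar>"
    by (rule power_gt_expt) (use prime_gt_1_nat[OF assms(1)] in simp)
  then have "int (nat \<bar>a\<bar>) < int (p ^ nat \<bar>a\<bar>)"
    by (simp only: of_nat_less_iff)
  ultimately show False by simp
qed

text \<open>
  Requiring the functionals of a key to be integral at its prime only, the \<open>p\<close>-divisible part of
  the group at that prime is exactly their common kernel.
\<close>

definition grp :: "(nat \<times> nat list) set \<Rightarrow> level_vec set"
  where "grp S = {v \<in> vecs. \<forall>k. \<forall>l\<in>functionals S k. l v \<in> local_ints (prime_of k)}"

definition vanishing :: "(nat \<times> nat list) set \<Rightarrow> key \<Rightarrow> level_vec set"
  where "vanishing S k = {v \<in> vecs. \<forall>l\<in>functionals S k. l v = 0}"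

lemma grp_vecs: "v \<in> grp S \<Longrightarrow> v \<in> vecs"
  by (simp add: grp_def)

lemma grp_functional: "v \<in> grp S \<Longrightarrow> l \<in> functionals S k \<Longrightarrow> l v \<in> local_ints (prime_of k)"
  by (simp add: grp_def)

lemma grpI:
  "v \<in> vecs \<Longrightarrow> (\<And>k l. l \<in> functionals S k \<Longrightarrow> l v \<in> local_ints (prime_of k)) \<Longrightarrow> v \<in> grp S"
  by (simp add: grp_def)

lemma grp_Ints:
  assumes "v \<in> vecs" "\<And>n z. v n z \<in> \<int>"
  shows "v \<in> grp S"
  by (rule grpI[OF assms(1)], rule local_ints_Ints[OF prime_prime_of], rule functional_Ints)
    (use assms in auto)

lemma grp_zero: "0 \<in> grp S"
  by (rule grp_Ints) (simp_all add: vecs_zero)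

lemma grp_add:
  assumes "v \<in> grp S" "w \<in> grp S"
  shows "v + w \<in> grp S"
proof (rule grpI)
  fix k l assume l: "l \<in> functionals S k"
  show "l (v + w) \<in> local_ints (prime_of k)"
    unfolding functional_add[OF l assms[THEN grp_vecs]]
    using assms[THEN grp_functional, OF l] by (rule local_ints_add[OF prime_prime_of])
qed (use assms grp_vecs vecs_add in blast)

lemma grp_scale_of_int:
  assumes "v \<in> grp S"
  shows "scale (of_int a) v \<in> grp S"
proof (rule grpI)
  fix k l assume l: "l \<in> functionals S k"
  show "l (scale (of_int a) v) \<in> local_ints (prime_of k)"
    unfolding functional_scale[OF l grp_vecs[OF assms]]
    by (intro local_ints_mult local_ints_Ints grp_functional[OF assms l] prime_prime_of) simp
qed (use assms grp_vecs vecs_scale in blast)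

lemma grp_scale_of_nat: "v \<in> grp S \<Longrightarrow> scale (of_nat a) v \<in> grp S"
  using grp_scale_of_int[of v S "int a"] by simp

lemma grp_uminus: "v \<in> grp S \<Longrightarrow> - v \<in> grp S"
  using grp_scale_of_int[of v S "- 1"] by (simp add: scale_minus_one)

lemma vanishing_scale_iff:
  assumes "q \<noteq> 0" "v \<in> vecs"
  shows "scale q v \<in> vanishing S k \<longleftrightarrow> v \<in> vanishing S k"
proof -
  have "l (scale q v) = 0 \<longleftrightarrow> l v = 0" if "l \<in> functionals S k" for l
    using functional_scale[OF that assms(2), of q] assms(1) by simp
  then show ?thesis
    unfolding vanishing_def using vecs_scale[OF assms(2)] assms(2) by blast
qed

text \<open>Division by a power of \<open>prime_of k\<close> multiplies the functionals of the other
  keys by a unit of their local ring, and keeps those of \<open>k\<close> integral when they vanish.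
  Conversely, a rational that can be divided by all powers of a prime inside its local ring is
  0.\<close>

lemma vanishing_iff_divisible:
  assumes v: "v \<in> grp S"
  shows "v \<in> vanishing S k \<longleftrightarrow> (\<forall>m. \<exists>w\<in>grp S. v = scale (of_nat (prime_of k ^ m)) w)"
proof
  assume ker: "v \<in> vanishing S k"
  show "\<forall>m. \<exists>w\<in>grp S. v = scale (of_nat (prime_of k ^ m)) w"
  proof
    fix m
    define p where "p = prime_of k"
    have p: "prime p" unfolding p_def by (rule prime_prime_of)
    define w where "w = scale (1 / of_nat p ^ m) v"
    have "w \<in> grp S"
    proof (rule grpI)
      fix k' l assume l: "l \<in> functionals S k'"
      have lw: "l w = 1 / of_nat p ^ m * l v"
        unfolding w_def by (rule functional_scale[OF l grp_vecs[OF v]])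
      show "l w \<in> local_ints (prime_of k')"
      proof (cases "k' = k")
        case True
        then have "l w = 0"
          using ker l lw by (simp add: vanishing_def)
        then show ?thesis by (simp add: local_ints_Ints prime_prime_of)
      next
        case False
        then have "1 / of_nat p ^ m \<in> local_ints (prime_of k')"
          unfolding p_def by (intro local_ints_inverse_power) (simp_all add: prime_prime_of prime_of_eq_iff)
        then show ?thesis
          unfolding lw using grp_functional[OF v l] by (rule local_ints_mult[OF prime_prime_of])
      qed
    qed (simp add: w_def vecs_scale grp_vecs[OF v])
    moreover have "v = scale (of_nat (p ^ m)) w"
      using prime_gt_0_nat[OF p] by (simp add: w_def)
    ultimately show "\<exists>w\<in>grp S. v = scale (of_nat (prime_of k ^ m)) w"
      unfolding p_def by blast
  qed
next
  assume div: "\<forall>m. \<exists>w\<in>grp S. v = scale (of_nat (prime_of k ^ m)) w"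
  have "l v = 0" if l: "l \<in> functionals S k" for l
  proof (rule local_ints_power_dvd_zero[OF prime_prime_of[of k]])
    fix m
    obtain w where w: "w \<in> grp S" "v = scale (of_nat (prime_of k ^ m)) w"
      using div by blast
    then have "l v = of_nat (prime_of k ^ m) * l w"
      using functional_scale[OF l grp_vecs[OF w(1)]] by simp
    then have "l v / of_nat (prime_of k) ^ m = l w"
      using prime_gt_0_nat[OF prime_prime_of[of k]] by simp
    then show "l v / of_nat (prime_of k) ^ m \<in> local_ints (prime_of k)"
      using grp_functional[OF w(1) l] by simp
  qed
  then show "v \<in> vanishing S k"
    using grp_vecs[OF v] by (simp add: vanishing_def)
qed

lemma common_denominator:
  assumes "finite V"
  shows "\<exists>N::nat. N > 0 \<and> (\<forall>x\<in>V. of_nat N * (x :: rat) \<in> \<int>)"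
  using assms
proof induction
  case (insert x V)
  then obtain N where N: "N > 0" "\<forall>y\<in>V. of_nat N * y \<in> \<int>" by blast
  obtain a b where ab: "quotient_of x = (a, b)" by fastforce
  then have "b > 0" "x = of_int a / of_int b"
    using quotient_of_denom_pos quotient_of_div by blast+
  then have "of_nat (N * nat b) * x = of_int (int N * a)"
    by simp
  moreover have "of_nat (N * nat b) * y = of_int b * (of_nat N * y)" for y :: rat
    using \<open>b > 0\<close> by simp
  ultimately have "of_nat (N * nat b) * y \<in> \<int>" if "y \<in> insert x V" for y
    using that N(2) by (metis Ints_mult Ints_of_int insert_iff)
  then show ?case
    using N(1) \<open>b > 0\<close> by (intro exI[of _ "N * nat b"]) simp
next
  case empty
  show ?case by (rule exI[of _ 1]) simp
qed

text \<open>A vector takes only finitely many values, by finite supports and eventual constancy, so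
  it has a common denominator. Hence \<open>vecs\<close> is the rational span of
  \<open>grp S\<close> for every \<open>S\<close>.\<close>

lemma multiple_in_grp:
  assumes v: "v \<in> vecs"
  shows "\<exists>N::nat. N > 0 \<and> scale (of_nat N) v \<in> grp S"
proof -
  obtain M where M: "\<And>n. n \<ge> M \<Longrightarrow> v n = limit v"
    using eventually_limit[OF v] unfolding eventually_sequentially by blast
  define V where "V = insert 0 (\<Union>n\<le>M. v n ` {z. v n z \<noteq> 0})"
  have "finite V" unfolding V_def using finite_support[OF v] by blast
  have "v n z \<in> V" for n z
  proof -
    have "v n z = v (min n M) z"
      using M[of n] M[of M] by (cases "n \<le> M") (auto simp: min_def)
    moreover have "v (min n M) z \<in> V" unfolding V_def by (cases "v (min n M) z = 0") auto
    ultimately show ?thesis by simp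
  qed
  then obtain N where "N > 0" "\<And>n z. of_nat N * v n z \<in> \<int>"
    using common_denominator[OF \<open>finite V\<close>] by blast
  then show ?thesis
    by (intro exI[of _ N] conjI grp_Ints[OF vecs_scale[OF v]]) (simp_all add: scale_def)
qed

lemma scale_minus: "scale (- q) v = - scale q v"
  by (simp add: scale_def fun_eq_iff)

section \<open>Isomorphisms of the groups come from permutations\<close>

definition grp_iso :: "(nat \<times> nat list) set \<Rightarrow> (nat \<times> nat list) set \<Rightarrow> (level_vec \<Rightarrow> level_vec) \<Rightarrow> bool"
  where "grp_iso S S' \<phi> \<longleftrightarrow> bij_betw \<phi> (grp S) (grp S') \<and>
    (\<forall>v\<in>grp S. \<forall>w\<in>grp S. \<phi> (v + w) = \<phi> v + \<phi> w)"

text \<open>Domain and range are the same space; \<open>S\<close> and \<open>S'\<close> make a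
  difference only in the subspace of \<open>KSet\<close>.\<close>

definition lin_iso :: "(nat \<times> nat list) set \<Rightarrow> (nat \<times> nat list) set \<Rightarrow> (level_vec \<Rightarrow> level_vec) \<Rightarrow> bool"
  where "lin_iso S S' F \<longleftrightarrow> bij_betw F vecs vecs \<and>
    (\<forall>v\<in>vecs. \<forall>w\<in>vecs. F (v + w) = F v + F w) \<and>
    (\<forall>q. \<forall>v\<in>vecs. F (scale q v) = scale q (F v)) \<and>
    (\<forall>k. \<forall>v\<in>vecs. F v \<in> vanishing S' k \<longleftrightarrow> v \<in> vanishing S k)"

lemma grp_iso_in: "grp_iso S S' \<phi> \<Longrightarrow> v \<in> grp S \<Longrightarrow> \<phi> v \<in> grp S'"
  unfolding grp_iso_def by (blast dest: bij_betwE)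

lemma grp_iso_add: "grp_iso S S' \<phi> \<Longrightarrow> v \<in> grp S \<Longrightarrow> w \<in> grp S \<Longrightarrow> \<phi> (v + w) = \<phi> v + \<phi> w"
  by (simp add: grp_iso_def)

lemma grp_iso_inverse:
  assumes "grp_iso S S' \<phi>"
  shows "grp_iso S' S (inv_into (grp S) \<phi>)"
proof -
  have bij: "bij_betw \<phi> (grp S) (grp S')" using assms by (simp add: grp_iso_def)
  let ?\<psi> = "inv_into (grp S) \<phi>"
  have bij': "bij_betw ?\<psi> (grp S') (grp S)" by (rule bij_betw_inv_into[OF bij])
  have "?\<psi> (v + w) = ?\<psi> v + ?\<psi> w" if vw: "v \<in> grp S'" "w \<in> grp S'" for v w
  proof (rule inv_into_f_eq)
    show "inj_on \<phi> (grp S)" using bij by (rule bij_betw_imp_inj_on)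
    have in_grp: "?\<psi> v \<in> grp S" "?\<psi> w \<in> grp S" using bij' vw by (blast dest: bij_betwE)+
    then show "?\<psi> v + ?\<psi> w \<in> grp S" by (rule grp_add)
    show "\<phi> (?\<psi> v + ?\<psi> w) = v + w"
      using grp_iso_add[OF assms in_grp] bij_betw_inv_into_right[OF bij] vw by simp
  qed
  then show ?thesis using bij' by (simp add: grp_iso_def)
qed

lemma grp_iso_scale_of_nat:
  assumes "grp_iso S S' \<phi>" "v \<in> grp S"
  shows "\<phi> (scale (of_nat n) v) = scale (of_nat n) (\<phi> v)"
proof (induction n)
  case 0
  have "\<phi> (0 + 0) = \<phi> 0 + \<phi> 0"
    by (rule grp_iso_add[OF assms(1)]) (rule grp_zero)+
  then have "\<phi> 0 = 0" by simp
  then show ?case by (simp only: of_nat_0 scale_zero)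
next
  case (Suc n)
  have Suc_scale: "scale (of_nat (Suc n)) w = scale (of_nat n) w + w" for w
    by (simp only: of_nat_Suc scale_add_left scale_one add.commute)
  show ?case
    unfolding Suc_scale grp_iso_add[OF assms(1) grp_scale_of_nat[OF assms(2)] assms(2)] Suc ..
qed

lemma grp_iso_scale_of_int:
  assumes "grp_iso S S' \<phi>" "v \<in> grp S"
  shows "\<phi> (scale (of_int a) v) = scale (of_int a) (\<phi> v)"
proof (cases a)
  case (nonneg n)
  then show ?thesis using grp_iso_scale_of_nat[OF assms, of n] by simp
next
  case (neg n)
  define w where "w = scale (of_nat (Suc n)) v"
  have w: "w \<in> grp S" unfolding w_def by (rule grp_scale_of_nat[OF assms(2)])
  have "\<phi> (w + - w) = \<phi> w + \<phi> (- w)"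
    by (rule grp_iso_add[OF assms(1) w grp_uminus[OF w]])
  moreover have "\<phi> 0 = 0"
    using grp_iso_scale_of_nat[OF assms, of 0] by simp
  ultimately have "\<phi> (- w) = - \<phi> w"
    by (simp add: add_eq_0_iff)
  moreover have "of_int a = - (of_nat (Suc n) :: rat)"
    using neg by simp
  ultimately show ?thesis
    using grp_iso_scale_of_nat[OF assms, of "Suc n"] unfolding w_def by (simp only: scale_minus)
qed

section \<open>Extension of group isomorphisms to the rational span\<close>

definition extend :: "(nat \<times> nat list) set \<Rightarrow> (level_vec \<Rightarrow> level_vec) \<Rightarrow> level_vec \<Rightarrow> level_vec"
  where "extend S \<phi> v = (let N = SOME N. N > 0 \<and> scale (of_nat N) v \<in> grp S in
    scale (1 / of_nat N) (\<phi> (scale (of_nat N) v)))"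

text \<open>The choice of the multiplier is harmless: by additivity, the results for
  \<open>m\<close> and for \<open>N\<close> agree after multiplication by
  \<open>m * N\<close>.\<close>

lemma extend_eq:
  assumes "grp_iso S S' \<phi>" "v \<in> vecs" "m > 0" "scale (of_nat m) v \<in> grp S"
  shows "extend S \<phi> v = scale (1 / of_nat m) (\<phi> (scale (of_nat m) v))"
proof -
  define N where "N = (SOME N. N > 0 \<and> scale (of_nat N) v \<in> grp S)"
  have N: "N > 0" "scale (of_nat N) v \<in> grp S"
    unfolding N_def using someI_ex[OF multiple_in_grp[OF assms(2), of S]] by blast+
  have "scale (of_nat m) (\<phi> (scale (of_nat N) v)) = \<phi> (scale (of_nat (m * N)) v)"
    using grp_iso_scale_of_nat[OF assms(1) N(2), of m] by simp
  moreover have "scale (of_nat N) (\<phi> (scale (of_nat m) v)) = \<phi> (scale (of_nat (m * N)) v)"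
    using grp_iso_scale_of_nat[OF assms(1,4), of N] by (simp add: mult.commute)
  ultimately have "scale (1 / of_nat (m * N)) (scale (of_nat m) (\<phi> (scale (of_nat N) v))) =
      scale (1 / of_nat (m * N)) (scale (of_nat N) (\<phi> (scale (of_nat m) v)))"
    by simp
  then show ?thesis
    unfolding extend_def N_def[symmetric] using N(1) assms(3) by simp
qed

lemma extend_inverse:
  assumes "grp_iso S S' \<phi>" "v \<in> vecs"
  shows "extend S \<phi> v \<in> vecs" "extend S' (inv_into (grp S) \<phi>) (extend S \<phi> v) = v"
proof -
  obtain N :: nat where N: "N > 0" "scale (of_nat N) v \<in> grp S"
    using multiple_in_grp[OF assms(2)] by blast
  have eq: "extend S \<phi> v = scale (1 / of_nat N) (\<phi> (scale (of_nat N) v))"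
    by (rule extend_eq[OF assms N])
  have im: "\<phi> (scale (of_nat N) v) \<in> grp S'"
    by (rule grp_iso_in[OF assms(1) N(2)])
  then show in_vecs: "extend S \<phi> v \<in> vecs"
    unfolding eq by (intro vecs_scale grp_vecs)
  have scaled: "scale (of_nat N) (extend S \<phi> v) = \<phi> (scale (of_nat N) v)"
    using N(1) by (simp add: eq)
  have "inv_into (grp S) \<phi> (\<phi> (scale (of_nat N) v)) = scale (of_nat N) v"
    using assms(1) bij_betw_inv_into_left[OF _ N(2)] unfolding grp_iso_def by blast
  moreover have "scale (of_nat N) (extend S \<phi> v) \<in> grp S'"
    using im scaled by simp
  ultimately show "extend S' (inv_into (grp S) \<phi>) (extend S \<phi> v) = v"
    using extend_eq[OF grp_iso_inverse[OF assms(1)] in_vecs N(1)] scaled N(1) by simp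
qed

lemma vanishing_grp_iso:
  assumes "grp_iso S S' \<phi>" "v \<in> grp S" "v \<in> vanishing S k"
  shows "\<phi> v \<in> vanishing S' k"
proof -
  have "\<exists>w\<in>grp S'. \<phi> v = scale (of_nat (prime_of k ^ m)) w" for m
  proof -
    obtain w where w: "w \<in> grp S" "v = scale (of_nat (prime_of k ^ m)) w"
      using assms(2,3) vanishing_iff_divisible by blast
    then show ?thesis
      using grp_iso_scale_of_nat[OF assms(1) w(1)] grp_iso_in[OF assms(1) w(1)] by blast
  qed
  then show ?thesis
    using vanishing_iff_divisible[OF grp_iso_in[OF assms(1,2)]] by blast
qed

lemma vanishing_extend:
  assumes "grp_iso S S' \<phi>" "v \<in> vanishing S k"
  shows "extend S \<phi> v \<in> vanishing S' k"
proof -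
  have v: "v \<in> vecs" using assms(2) by (simp add: vanishing_def)
  obtain N :: nat where N: "N > 0" "scale (of_nat N) v \<in> grp S"
    using multiple_in_grp[OF v] by blast
  then have "scale (of_nat N) v \<in> vanishing S k"
    using vanishing_scale_iff[OF _ v] assms(2) by simp
  then have "\<phi> (scale (of_nat N) v) \<in> vanishing S' k"
    by (rule vanishing_grp_iso[OF assms(1) N(2)])
  then show ?thesis
    unfolding extend_eq[OF assms(1) v N]
    using vanishing_scale_iff N(1) grp_vecs[OF grp_iso_in[OF assms(1) N(2)]] by simp
qed

lemma lin_iso_extend:
  assumes iso: "grp_iso S S' \<phi>"
  shows "lin_iso S S' (extend S \<phi>)"
proof -
  let ?F = "extend S \<phi>"
  let ?G = "extend S' (inv_into (grp S) \<phi>)"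
  have inv_iso: "grp_iso S' S (inv_into (grp S) \<phi>)"
    by (rule grp_iso_inverse[OF iso])
  have GF: "?G (?F v) = v" if "v \<in> vecs" for v
    by (rule extend_inverse(2)[OF iso that])
  have FG: "?F (?G v) = v" if v: "v \<in> vecs" for v
  proof -
    obtain N :: nat where N: "N > 0" "scale (of_nat N) v \<in> grp S'"
      using multiple_in_grp[OF v] by blast
    have "scale (of_nat N) (?G v) = inv_into (grp S) \<phi> (scale (of_nat N) v)"
      using extend_eq[OF inv_iso v N] N(1) by simp
    moreover have "inv_into (grp S) \<phi> (scale (of_nat N) v) \<in> grp S"
      by (rule grp_iso_in[OF inv_iso N(2)])
    moreover have "\<phi> (inv_into (grp S) \<phi> (scale (of_nat N) v)) = scale (of_nat N) v"
      using iso bij_betw_inv_into_right[OF _ N(2)] unfolding grp_iso_def by blast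
    ultimately show ?thesis
      using extend_eq[OF iso extend_inverse(1)[OF inv_iso v] N(1)] N(1) by simp
  qed
  have "bij_betw ?F vecs vecs"
    by (rule bij_betw_byWitness[where f' = ?G])
      (use GF FG extend_inverse(1)[OF iso] extend_inverse(1)[OF inv_iso] in auto)
  moreover have "?F (v + w) = ?F v + ?F w" if vw: "v \<in> vecs" "w \<in> vecs" for v w
  proof -
    obtain M N :: nat where M: "M > 0" "scale (of_nat M) v \<in> grp S"
      and N: "N > 0" "scale (of_nat N) w \<in> grp S"
      using multiple_in_grp vw by meson
    have pos: "M * N > 0" using M N by simp
    have v: "scale (of_nat (M * N)) v \<in> grp S"
      using grp_scale_of_nat[OF M(2), of N] by (simp add: mult.commute)
    have w: "scale (of_nat (M * N)) w \<in> grp S"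
      using grp_scale_of_nat[OF N(2), of M] by simp
    have "scale (of_nat (M * N)) (v + w) = scale (of_nat (M * N)) v + scale (of_nat (M * N)) w"
      by (rule scale_add)
    then show ?thesis
      using extend_eq[OF iso vecs_add[OF vw] pos] extend_eq[OF iso vw(1) pos v]
        extend_eq[OF iso vw(2) pos w] grp_iso_add[OF iso v w] grp_add[OF v w]
      by (metis scale_add)
  qed
  moreover have "?F (scale q v) = scale q (?F v)" if v: "v \<in> vecs" for q v
  proof -
    obtain N :: nat where N: "N > 0" "scale (of_nat N) v \<in> grp S"
      using multiple_in_grp[OF v] by blast
    obtain a d where ad: "quotient_of q = (a, d)" by fastforce
    define b where "b = nat d"
    have ab: "q = of_int a / of_nat b" "b > 0"
      unfolding b_def using quotient_of_denom_pos[OF ad] quotient_of_div[OF ad] by simp_all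
    have eq: "scale (of_nat (b * N)) (scale q v) = scale (of_int a) (scale (of_nat N) v)"
      using ab by (simp add: mult.commute)
    have "scale (of_nat (b * N)) (scale q v) \<in> grp S"
      unfolding eq by (rule grp_scale_of_int[OF N(2)])
    then have "?F (scale q v) = scale (1 / of_nat (b * N)) (\<phi> (scale (of_int a) (scale (of_nat N) v)))"
      using extend_eq[OF iso vecs_scale[OF v], of "b * N" q] ab(2) N(1) eq by simp
    also have "\<dots> = scale q (?F v)"
      using grp_iso_scale_of_int[OF iso N(2), of a] extend_eq[OF iso v N] ab by simp
    finally show ?thesis .
  qed
  moreover have "?F v \<in> vanishing S' k \<longleftrightarrow> v \<in> vanishing S k" if "v \<in> vecs" for v k
    using vanishing_extend[OF iso] vanishing_extend[OF inv_iso] GF[OF that] by metis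
  ultimately show ?thesis by (simp add: lin_iso_def)
qed

lemma lin_iso_inverse:
  assumes "lin_iso S S' F"
  shows "lin_iso S' S (inv_into vecs F)"
proof -
  have bij: "bij_betw F vecs vecs" using assms by (simp add: lin_iso_def)
  let ?G = "inv_into vecs F"
  have inj: "inj_on F vecs" using bij by (rule bij_betw_imp_inj_on)
  have bij': "bij_betw ?G vecs vecs" by (rule bij_betw_inv_into[OF bij])
  then have G: "?G v \<in> vecs" if "v \<in> vecs" for v using that by (blast dest: bij_betwE)
  have FG: "F (?G v) = v" if "v \<in> vecs" for v by (rule bij_betw_inv_into_right[OF bij that])
  have "?G (v + w) = ?G v + ?G w" if vw: "v \<in> vecs" "w \<in> vecs" for v w
    by (rule inv_into_f_eq[OF inj vecs_add]) (use assms vw G FG in \<open>auto simp: lin_iso_def\<close>)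
  moreover have "?G (scale q v) = scale q (?G v)" if v: "v \<in> vecs" for q v
    by (rule inv_into_f_eq[OF inj vecs_scale]) (use assms v G FG in \<open>auto simp: lin_iso_def\<close>)
  moreover have "?G v \<in> vanishing S k \<longleftrightarrow> v \<in> vanishing S' k" if "v \<in> vecs" for v k
    using assms G[OF that] FG[OF that] unfolding lin_iso_def by metis
  ultimately show ?thesis using bij' by (simp add: lin_iso_def)
qed

section \<open>Linear isomorphisms act on each level as a unit of the group ring\<close>

lemma vanishing_KSrc:
  "v \<in> vanishing S (KSrc n) \<longleftrightarrow> v \<in> vecs \<and> (\<forall>m z. m \<noteq> n \<or> \<not> is_Src z \<longrightarrow> v m z = 0)"
  unfolding vanishing_def by auto

lemma vanishing_KTgt:
  "v \<in> vanishing S (KTgt n) \<longleftrightarrow> v \<in> vecs \<and> (\<forall>m z. m \<noteq> n \<or> is_Src z \<longrightarrow> v m z = 0)"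
  unfolding vanishing_def by auto

lemma vanishing_KNull: "v \<in> vanishing S (KNull n) \<longleftrightarrow> v \<in> vecs \<and> (\<forall>z. v n z = 0)"
  unfolding vanishing_def by auto

lemma vanishing_KMap:
  "v \<in> vanishing S (KMap n y) \<longleftrightarrow> v \<in> vecs \<and> (\<forall>m z. m \<noteq> n \<longrightarrow> v m z = 0) \<and>
    (\<forall>z. \<not> is_Src z \<longrightarrow> v n z = src_sum (v n) y z)"
proof -
  have "(\<forall>l\<in>functionals S (KMap n y). l v = 0) \<longleftrightarrow> (\<forall>m z. m \<noteq> n \<longrightarrow> v m z = 0) \<and>
      (\<forall>z. \<not> is_Src z \<longrightarrow> v n z - src_sum (v n) y z = 0)"
    unfolding functionals.simps ball_Un by auto
  then show ?thesis unfolding vanishing_def by simp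
qed

lemma vanishing_KSet:
  "v \<in> vanishing S KSet \<longleftrightarrow> v \<in> vecs \<and> (\<forall>t xs. (t, xs) \<notin> S \<longrightarrow> limit v (Tup t xs) = 0)"
  unfolding vanishing_def by auto

lemma sum_vecs:
  assumes "finite H"
  shows "(\<Sum>h\<in>H. scale (c h) (unit_vec n (f h))) \<in> vecs"
  using assms
  by induction (simp_all only: sum.empty sum.insert not_False_eq_True vecs_zero vecs_add vecs_scale unit_vec_vecs)

lemma lin_iso_sum:
  assumes "lin_iso S S' F" "finite H"
  shows "F (\<Sum>h\<in>H. scale (c h) (unit_vec n (f h))) = (\<Sum>h\<in>H. scale (c h) (F (unit_vec n (f h))))"
  using assms(2)
proof induction
  case empty
  have "F (scale 0 0) = scale 0 (F 0)"
    using assms(1) vecs_zero unfolding lin_iso_def by blast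
  then show ?case by (simp only: scale_zero sum.empty)
next
  case (insert h H)
  have "F (scale (c h) (unit_vec n (f h)) + (\<Sum>h\<in>H. scale (c h) (unit_vec n (f h)))) =
      F (scale (c h) (unit_vec n (f h))) + F (\<Sum>h\<in>H. scale (c h) (unit_vec n (f h)))"
    using assms(1) vecs_scale[OF unit_vec_vecs] sum_vecs[OF insert(1)] unfolding lin_iso_def by blast
  moreover have "F (scale (c h) (unit_vec n (f h))) = scale (c h) (F (unit_vec n (f h)))"
    using assms(1) unit_vec_vecs unfolding lin_iso_def by blast
  ultimately show ?case using insert by (simp only: sum.insert not_False_eq_True)
qed

lemma sum_vec_apply: "(\<Sum>h\<in>H. f h :: level_vec) n z = (\<Sum>h\<in>H. f h n z)"
  by (induction H rule: infinite_finite_induct) simp_all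

text \<open>\<open>unit_vec n (Src 0) + unit_vec n y\<close> lies on the graph named by
  \<open>KMap n y\<close>, because \<open>shift 0 y = y\<close>. Its image lies on the same graph,
  with \<open>Src\<close> part \<open>s\<close> and remaining part \<open>t\<close>, so
  \<open>t\<close> can be read off from \<open>s\<close>.\<close>

lemma lin_iso_unit_vec:
  assumes iso: "lin_iso S S' F" and y: "\<not> is_Src y"
  shows "F (unit_vec n y) m z =
    (if m = n \<and> \<not> is_Src z then src_sum (F (unit_vec n (Src 0)) n) y z else 0)"
proof -
  define s where "s = F (unit_vec n (Src 0))"
  define t where "t = F (unit_vec n y)"
  have ker: "F v \<in> vanishing S' k" if "v \<in> vanishing S k" for v k
    using that iso unfolding lin_iso_def vanishing_def by blast
  have "unit_vec n (Src 0) \<in> vanishing S (KSrc n)"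
    unfolding vanishing_KSrc by (auto simp: unit_vec_vecs) (auto simp: unit_vec_def)
  then have s: "s \<in> vecs" "\<And>m z. m \<noteq> n \<or> \<not> is_Src z \<Longrightarrow> s m z = 0"
    using ker[of "unit_vec n (Src 0)" "KSrc n"] unfolding s_def vanishing_KSrc[of "F v" for v] by blast+
  have "unit_vec n y \<in> vanishing S (KTgt n)"
    unfolding vanishing_KTgt using y by (auto simp: unit_vec_vecs) (auto simp: unit_vec_def)
  then have t: "t \<in> vecs" "\<And>m z. m \<noteq> n \<or> is_Src z \<Longrightarrow> t m z = 0"
    using ker[of "unit_vec n y" "KTgt n"] unfolding t_def vanishing_KTgt[of "F v" for v] by blast+
  have "src_sum ((unit_vec n (Src 0) + unit_vec n y) n) y z = (if z = y then 1 else 0)" for z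
  proof -
    have "src_sum ((unit_vec n (Src 0) + unit_vec n y) n) y z =
        (\<Sum>h\<in>{0}. if shift h y = z then (unit_vec n (Src 0) + unit_vec n y) n (Src h) else 0)"
      by (rule src_sum_eq) (use y in \<open>auto simp: unit_vec_def\<close>)
    also have "\<dots> = (if z = y then 1 else 0)"
      using y by (auto simp: unit_vec_def)
    finally show ?thesis .
  qed
  then have "unit_vec n (Src 0) + unit_vec n y \<in> vanishing S (KMap n y)"
    unfolding vanishing_KMap using y by (auto simp: vecs_add unit_vec_vecs) (auto simp: unit_vec_def)
  then have "s + t \<in> vanishing S' (KMap n y)"
    using ker[of "unit_vec n (Src 0) + unit_vec n y"] iso unit_vec_vecs
    unfolding s_def t_def lin_iso_def by metis
  then have map: "\<not> is_Src z \<Longrightarrow> (s + t) n z = src_sum ((s + t) n) y z" for z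
    unfolding vanishing_KMap by blast
  \<comment> \<open>\<open>t\<close> has no \<open>Src\<close> coordinates and contributes
    nothing.\<close>
  have "src_sum ((s + t) n) y z = src_sum (s n) y z"
    unfolding src_sum_def using t(2) by simp
  then have "t m z = (if m = n \<and> \<not> is_Src z then src_sum (s n) y z else 0)"
    using map[of z] s(2) t(2) by auto
  then show ?thesis unfolding s_def t_def .
qed

text \<open>On the copy \<open>Reg\<close>, the map \<open>F\<close> and its inverse
  \<open>G\<close> are left multiplications by \<open>u\<close> and \<open>u'\<close>. Applying
  \<open>F\<close> to \<open>G (unit_vec n (Reg 0))\<close> shows that the product of
  \<open>u\<close> and \<open>u'\<close> is 1, so \<open>u\<close> is a monomial by
  \<open>trivial_unit\<close>. The same \<open>u\<close> governs every \<open>y\<close> outside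
  \<open>Src\<close>, tuples included.\<close>

lemma lin_iso_monomial:
  assumes iso: "lin_iso S S' F"
  shows "\<exists>g c. c \<noteq> 0 \<and> (\<forall>y. \<not> is_Src y \<longrightarrow> F (unit_vec n y) = scale c (unit_vec n (shift g y)))"
proof -
  define G where "G = inv_into vecs F"
  have iso': "lin_iso S' S G" unfolding G_def by (rule lin_iso_inverse[OF iso])
  have FG: "F (G v) = v" if "v \<in> vecs" for v
    unfolding G_def using iso bij_betw_inv_into_right[OF _ that] by (auto simp: lin_iso_def)
  define u where "u h = F (unit_vec n (Src 0)) n (Src h)" for h
  define u' where "u' h = G (unit_vec n (Src 0)) n (Src h)" for h
  have vF: "F (unit_vec n (Src 0)) \<in> vecs" and vG: "G (unit_vec n (Src 0)) \<in> vecs"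
    using iso iso' unit_vec_vecs unfolding lin_iso_def by (blast dest: bij_betwE)+
  have fin: "finite {h. u h \<noteq> 0}" "finite {h. u' h \<noteq> 0}"
    unfolding u_def u'_def using finite_src_support vF vG by blast+
  have sum_reg: "src_sum f (Reg h) (Reg k) = f (Src (k - h))" for f h k
  proof -
    have "{g. f (Src g) \<noteq> 0 \<and> shift g (Reg h) = Reg k} = (if f (Src (k - h)) = 0 then {} else {k - h})"
      by (auto simp: algebra_simps)
    then show ?thesis unfolding src_sum_def by simp
  qed
  have sum_reg': "src_sum f (Reg h) (Tup t xs) = 0" for f h t xs
    by (simp add: src_sum_def)
  have F_reg: "F (unit_vec n (Reg h)) n (Reg k) = u (k - h)" for h k
    by (simp add: lin_iso_unit_vec[OF iso] sum_reg u_def)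
  have G_reg: "G (unit_vec n (Reg 0)) = (\<Sum>h | u' h \<noteq> 0. scale (u' h) (unit_vec n (Reg h)))"
  proof (rule ext)+
    fix m z
    have "G (unit_vec n (Reg 0)) m z = (if m = n then (case z of Reg k \<Rightarrow> u' k | _ \<Rightarrow> 0) else 0)"
      by (cases z) (simp_all add: lin_iso_unit_vec[OF iso'] sum_reg sum_reg' u'_def)
    moreover have "(\<Sum>h | u' h \<noteq> 0. scale (u' h) (unit_vec n (Reg h))) m z =
        (\<Sum>h | u' h \<noteq> 0. if m = n \<and> z = Reg h then u' h else 0)"
      unfolding sum_vec_apply by (rule sum.cong) (simp_all add: scale_apply unit_vec_def)
    moreover have "\<dots> = (if m = n then (case z of Reg k \<Rightarrow> u' k | _ \<Rightarrow> 0) else 0)"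
      using fin(2) by (cases z) (simp_all add: sum.delta')
    ultimately show "G (unit_vec n (Reg 0)) m z =
        (\<Sum>h | u' h \<noteq> 0. scale (u' h) (unit_vec n (Reg h))) m z"
      by simp
  qed
  have "(\<Sum>g | u' g \<noteq> 0. u (h - g) * u' g) = (if h = 0 then 1 else 0)" for h
  proof -
    have "unit_vec n (Reg 0) = F (\<Sum>h | u' h \<noteq> 0. scale (u' h) (unit_vec n (Reg h)))"
      using FG[OF unit_vec_vecs] G_reg by metis
    also have "\<dots> = (\<Sum>g | u' g \<noteq> 0. scale (u' g) (F (unit_vec n (Reg g))))"
      by (rule lin_iso_sum[OF iso fin(2)])
    finally have "unit_vec n (Reg 0) n (Reg h) = (\<Sum>g | u' g \<noteq> 0. u' g * u (h - g))"
      by (simp add: sum_vec_apply scale_apply F_reg)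
    then show ?thesis by (simp add: unit_vec_def mult.commute)
  qed
  then obtain g c where c: "c \<noteq> 0" and u: "\<And>h. u h = (if h = g then c else 0)"
    using trivial_unit[OF gam_add_strict_left_mono fin] by blast
  have "F (unit_vec n y) = scale c (unit_vec n (shift g y))" if y: "\<not> is_Src y" for y
  proof (rule ext)+
    fix m z
    have "{h. u h \<noteq> 0 \<and> shift h y = z} = (if shift g y = z then {g} else {})"
      using u c by auto
    then have "src_sum (F (unit_vec n (Src 0)) n) y z = (if shift g y = z then c else 0)"
      unfolding src_sum_def u_def[symmetric] using u by simp
    then show "F (unit_vec n y) m z = scale c (unit_vec n (shift g y)) m z"
      using y unfolding lin_iso_unit_vec[OF iso y] by (auto simp: scale_apply unit_vec_def)
  qed
  then show ?thesis using c by blast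
qed

text \<open>A nonzero multiple of a basis vector determines that basis vector, so monomials that are
  eventually constant have an eventually constant position.\<close>

lemma limit_vec_eventually:
  assumes "\<forall>\<^sub>F n in sequentially. c n \<noteq> (0 :: rat)"
    and "\<forall>\<^sub>F n in sequentially. (\<lambda>z. if z = f n then c n else 0) = l"
  shows "\<exists>y. l y \<noteq> 0 \<and> (\<forall>\<^sub>F n in sequentially. f n = y)"
proof -
  have ev: "\<forall>\<^sub>F n in sequentially. c n \<noteq> 0 \<and> (\<lambda>z. if z = f n then c n else 0) = l"
    using assms by eventually_elim simp
  obtain N where N: "c N \<noteq> 0" "(\<lambda>z. if z = f N then c N else 0) = l"
    using eventually_happens'[OF sequentially_bot ev] by blast
  from ev have "\<forall>\<^sub>F n in sequentially. f n = f N"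
  proof eventually_elim
    case (elim n)
    have "l (f n) \<noteq> 0" using elim by auto
    then have "(if f n = f N then c N else 0) \<noteq> 0"
      unfolding N(2)[symmetric] .
    then show ?case by (simp split: if_splits)
  qed
  moreover have "l (f N) \<noteq> 0" using N by auto
  ultimately show ?thesis by blast
qed

text \<open>The constant sequence at \<open>Tup 0 [i]\<close> has an eventually constant image,
  which yields \<open>s i\<close> as the limit of \<open>act (g n) i\<close>. The constant sequence
  at a member of \<open>S\<close> has an image with limit supported in \<open>S'\<close>, by
  \<open>KSet\<close>. Bijectivity of \<open>s\<close> is not claimed yet: a pointwise limit of
  permutations may miss values.\<close>

lemma lin_iso_eventual_permutation:
  assumes iso: "lin_iso S S' F"
  shows "\<exists>g s. (\<forall>i. \<forall>\<^sub>F n in sequentially. act (g n) i = s i) \<and>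
    (\<forall>n y. \<not> is_Src y \<longrightarrow> (\<exists>c. c \<noteq> 0 \<and> F (unit_vec n y) = scale c (unit_vec n (shift (g n) y)))) \<and>
    (\<forall>t xs. (t, xs) \<in> S \<longrightarrow> (t, map s xs) \<in> S')"
proof -
  obtain g c where c: "\<And>n. c n \<noteq> 0"
    and F: "\<And>n y. \<not> is_Src y \<Longrightarrow> F (unit_vec n y) = scale (c n) (unit_vec n (shift (g n) y))"
    using lin_iso_monomial[OF iso] by metis
  have F_add: "F (v + w) = F v + F w" if "v \<in> vecs" "w \<in> vecs" for v w
    using iso that unfolding lin_iso_def by blast
  have F_vecs: "F v \<in> vecs" if "v \<in> vecs" for v
    using iso that unfolding lin_iso_def by (blast dest: bij_betwE)
  \<comment> \<open>\<open>KNull n\<close> separates the levels: the constant sequence and the basis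
    vector at level \<open>n\<close> differ by a vector that vanishes there, and so do their
    images.\<close>
  have level: "F (const_vec (Tup t xs)) n = (\<lambda>z. if z = shift (g n) (Tup t xs) then c n else 0)" for t xs n
  proof -
    define w where "w = const_vec (Tup t xs) + scale (- 1) (unit_vec n (Tup t xs))"
    have w: "w \<in> vecs"
      unfolding w_def by (intro vecs_add vecs_scale const_vec_vecs unit_vec_vecs)
    have "w n z = 0" for z
      by (simp add: w_def const_vec_def unit_vec_def scale_apply)
    then have "w \<in> vanishing S (KNull n)"
      using w by (simp add: vanishing_KNull)
    then have "F w \<in> vanishing S' (KNull n)"
      using iso w unfolding lin_iso_def by blast
    then have Fw: "F w n z = 0" for z by (simp add: vanishing_KNull)
    have "const_vec (Tup t xs) = w + unit_vec n (Tup t xs)"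
      by (simp add: w_def fun_eq_iff scale_apply)
    then have "F (const_vec (Tup t xs)) = F w + F (unit_vec n (Tup t xs))"
      using F_add[OF w unit_vec_vecs] by metis
    then have "F (const_vec (Tup t xs)) n z = F (unit_vec n (Tup t xs)) n z" for z
      using Fw by simp
    then show ?thesis
      using F[of "Tup t xs" n] by (intro ext) (simp add: scale_apply unit_vec_def)
  qed
  have ev: "\<exists>y. limit (F (const_vec (Tup t xs))) y \<noteq> 0 \<and>
      (\<forall>\<^sub>F n in sequentially. shift (g n) (Tup t xs) = y)" for t xs
    by (rule limit_vec_eventually[of c])
      (use eventually_limit[OF F_vecs[OF const_vec_vecs[of t xs]]] c in \<open>auto simp: level\<close>)
  have "\<exists>k. \<forall>\<^sub>F n in sequentially. act (g n) i = k" for i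
  proof -
    obtain y where y: "\<forall>\<^sub>F n in sequentially. shift (g n) (Tup 0 [i]) = y"
      using ev by blast
    obtain N where N: "shift (g N) (Tup 0 [i]) = y"
      using eventually_happens'[OF sequentially_bot y] by blast
    from y have "\<forall>\<^sub>F n in sequentially. act (g n) i = act (g N) i"
      by eventually_elim (use N in auto)
    then show ?thesis by blast
  qed
  then obtain s where s: "\<And>i. \<forall>\<^sub>F n in sequentially. act (g n) i = s i"
    by metis
  have "(t, map s xs) \<in> S'" if tx: "(t, xs) \<in> S" for t xs
  proof -
    have "const_vec (Tup t xs) \<in> vanishing S KSet"
      using tx by (auto simp: vanishing_KSet const_vec_vecs limit_const_vec)
    then have "F (const_vec (Tup t xs)) \<in> vanishing S' KSet"
      using iso const_vec_vecs unfolding lin_iso_def by blast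
    then have zero: "(t', xs') \<notin> S' \<Longrightarrow> limit (F (const_vec (Tup t xs))) (Tup t' xs') = 0" for t' xs'
      by (simp add: vanishing_KSet)
    obtain y where y: "limit (F (const_vec (Tup t xs))) y \<noteq> 0"
      "\<forall>\<^sub>F n in sequentially. shift (g n) (Tup t xs) = y"
      using ev by blast
    have "\<forall>\<^sub>F n in sequentially. \<forall>i\<in>set xs. act (g n) i = s i"
      by (rule eventually_ball_finite) (use s in auto)
    with y(2) have "\<forall>\<^sub>F n in sequentially. y = Tup t (map s xs)"
      by eventually_elim auto
    then have "y = Tup t (map s xs)" by simp
    then show ?thesis using zero y(1) by blast
  qed
  moreover have "\<exists>c. c \<noteq> 0 \<and> F (unit_vec n y) = scale c (unit_vec n (shift (g n) y))"
    if "\<not> is_Src y" for n y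
    using F[OF that] c by blast
  ultimately show ?thesis
    by (intro exI[of _ g] exI[of _ s] conjI allI impI s)
qed

definition tagged_iso :: "(nat \<times> nat list) set \<Rightarrow> (nat \<times> nat list) set \<Rightarrow> (nat \<Rightarrow> nat) \<Rightarrow> bool"
  where "tagged_iso S S' \<sigma> \<longleftrightarrow> bij \<sigma> \<and> (\<forall>t xs. (t, xs) \<in> S \<longleftrightarrow> (t, map \<sigma> xs) \<in> S')"

text \<open>\<open>F\<close> and its inverse yield limits \<open>s\<close> and \<open>s'\<close>. At
  every level the two permutations cancel, which passes to the limit and makes \<open>s\<close> and
  \<open>s'\<close> mutually inverse. The backward direction of the membership equivalence comes
  from \<open>s'\<close>.\<close>

lemma tagged_iso_if_lin_iso:
  assumes iso: "lin_iso S S' F"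
  shows "\<exists>\<sigma>. tagged_iso S S' \<sigma>"
proof -
  let ?G = "inv_into vecs F"
  have iso': "lin_iso S' S ?G" by (rule lin_iso_inverse[OF iso])
  have bij: "bij_betw F vecs vecs" using iso by (simp add: lin_iso_def)
  have GF: "?G (F v) = v" if "v \<in> vecs" for v
    by (rule bij_betw_inv_into_left[OF bij that])
  obtain g s where
    s: "\<And>i. \<forall>\<^sub>F n in sequentially. act (g n) i = s i" and
    F: "\<And>n y. \<not> is_Src y \<Longrightarrow> \<exists>c. c \<noteq> 0 \<and> F (unit_vec n y) = scale c (unit_vec n (shift (g n) y))" and
    S: "\<And>t xs. (t, xs) \<in> S \<Longrightarrow> (t, map s xs) \<in> S'"
    using lin_iso_eventual_permutation[OF iso] by metis
  obtain g' s' where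
    s': "\<And>i. \<forall>\<^sub>F n in sequentially. act (g' n) i = s' i" and
    G: "\<And>n y. \<not> is_Src y \<Longrightarrow> \<exists>c. c \<noteq> 0 \<and> ?G (unit_vec n y) = scale c (unit_vec n (shift (g' n) y))" and
    S': "\<And>t xs. (t, xs) \<in> S' \<Longrightarrow> (t, map s' xs) \<in> S"
    using lin_iso_eventual_permutation[OF iso'] by metis
  have cancel: "act (g' n) (act (g n) i) = i" for n i
  proof -
    define y where "y = Tup 0 [i]"
    have y: "\<not> is_Src y" by (simp add: y_def)
    obtain c where c: "c \<noteq> 0" "F (unit_vec n y) = scale c (unit_vec n (shift (g n) y))"
      using F[OF y] by blast
    obtain c' where c': "c' \<noteq> 0"
      "?G (unit_vec n (shift (g n) y)) = scale c' (unit_vec n (shift (g' n) (shift (g n) y)))"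
      using G[of "shift (g n) y"] y by auto
    have "unit_vec n y = ?G (scale c (unit_vec n (shift (g n) y)))"
      using GF[OF unit_vec_vecs] c(2) by metis
    also have "\<dots> = scale c (?G (unit_vec n (shift (g n) y)))"
      using iso' unit_vec_vecs unfolding lin_iso_def by blast
    also have "\<dots> = scale (c * c') (unit_vec n (shift (g' n) (shift (g n) y)))"
      by (simp add: c'(2))
    \<comment> \<open>The left side is 1, so the basis vector on the right must sit at
      \<open>y\<close>, whatever the scalar.\<close>
    finally have "unit_vec n y n y = scale (c * c') (unit_vec n (shift (g' n) (shift (g n) y))) n y"
      by (rule arg_cong)
    then have "shift (g' n) (shift (g n) y) = y"
      by (simp add: unit_vec_def scale_apply split: if_splits)
    then show ?thesis by (simp add: y_def)
  qed
  have s's: "s' (s i) = i" for i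
  proof -
    have "\<forall>\<^sub>F n in sequentially. s' (s i) = i"
      using s[of i] s'[of "s i"] by eventually_elim (metis cancel)
    then show ?thesis by simp
  qed
  have cancel': "act (g n) (act (g' n) i) = i" for n i
    using cancel bij_act by (metis bij_pointE)
  have ss': "s (s' i) = i" for i
  proof -
    have "\<forall>\<^sub>F n in sequentially. s (s' i) = i"
      using s'[of i] s[of "s' i"] by eventually_elim (metis cancel')
    then show ?thesis by simp
  qed
  have "bij s"
    by (rule bij_betw_byWitness[where f' = s']) (use s's ss' in auto)
  moreover have "(t, xs) \<in> S" if "(t, map s xs) \<in> S'" for t xs
    using S'[OF that] s's by (simp add: comp_def)
  ultimately show ?thesis
    using S unfolding tagged_iso_def by blast
qed

section \<open>From permutations to isomorphisms of the groups\<close>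

definition twist :: "(nat \<Rightarrow> gam) \<Rightarrow> level_vec \<Rightarrow> level_vec"
  where "twist g v = (\<lambda>n z. v n (shift (- g n) z))"

lemma twist_vecs:
  assumes ev: "\<And>i. \<forall>\<^sub>F n in sequentially. act (g n) i = \<sigma> i" and "bij \<sigma>" and v: "v \<in> vecs"
  shows "twist g v \<in> vecs" "limit (twist g v) (Tup t xs) = limit v (Tup t (map (inv_into UNIV \<sigma>) xs))"
proof -
  define l where "l z = (case z of Tup t xs \<Rightarrow> limit v (Tup t (map (inv_into UNIV \<sigma>) xs)) | _ \<Rightarrow> 0)" for z
  have \<sigma>: "inv_into UNIV \<sigma> (\<sigma> i) = i" "\<sigma> (inv_into UNIV \<sigma> i) = i" for i
    using assms(2) by (simp_all add: bij_is_inj bij_is_surj surj_f_inv_f)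
  \<comment> \<open>The numbers that occur in the limit form a finite set, so from some level on
    \<open>g n\<close> agrees with \<sigma> on all of them.\<close>
  define I where "I = (\<Union>z\<in>{z. limit v z \<noteq> 0}. case z of Tup t xs \<Rightarrow> set xs | _ \<Rightarrow> {})"
  have I: "i \<in> I" if "limit v (Tup t ys) \<noteq> 0" "i \<in> set ys" for i t ys
    unfolding I_def by (rule UN_I[of "Tup t ys"]) (use that in simp_all)
  have "finite I"
    unfolding I_def using finite_support_limit[OF v] by (auto split: idx.split)
  then have "\<forall>\<^sub>F n in sequentially. \<forall>i\<in>I. act (g n) i = \<sigma> i"
    by (rule eventually_ball_finite) (use ev in auto)
  then have lim: "\<forall>\<^sub>F n in sequentially. twist g v n = l"
    using eventually_limit[OF v]
  proof eventually_elim
    case (elim n)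
    \<comment> \<open>If either coefficient is nonzero, its tuple has all entries in
      \<open>I\<close>, where \<open>g n\<close> and \<sigma> agree; then both inverses send
      \<open>xs\<close> to the same tuple. Otherwise both sides are 0.\<close>
    have Tup: "limit v (Tup t (map (act (- g n)) xs)) = limit v (Tup t (map (inv_into UNIV \<sigma>) xs))" for t xs
    proof (cases "limit v (Tup t (map (act (- g n)) xs)) \<noteq> 0 \<or> limit v (Tup t (map (inv_into UNIV \<sigma>) xs)) \<noteq> 0")
      case True
      then have "map (act (- g n)) xs = map (inv_into UNIV \<sigma>) xs"
      proof
        assume "limit v (Tup t (map (act (- g n)) xs)) \<noteq> 0"
        then have "\<forall>i\<in>set (map (act (- g n)) xs). act (g n) i = \<sigma> i"
          using elim(1) I by blast
        then have "\<forall>i\<in>set xs. act (g n) (act (- g n) i) = \<sigma> (act (- g n) i)" by simp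
        then have "\<forall>i\<in>set xs. i = \<sigma> (act (- g n) i)"
          using act_add[of "g n" "- g n"] by (simp add: act_zero fun_eq_iff)
        then show ?thesis using \<sigma> by (metis map_cong)
      next
        assume "limit v (Tup t (map (inv_into UNIV \<sigma>) xs)) \<noteq> 0"
        then have "\<forall>i\<in>set (map (inv_into UNIV \<sigma>) xs). act (g n) i = \<sigma> i"
          using elim(1) I by blast
        then have "\<forall>i\<in>set xs. act (g n) (inv_into UNIV \<sigma> i) = i" using \<sigma> by simp
        moreover have "act (- g n) (act (g n) i) = i" for i
          using act_add[of "- g n" "g n"] by (simp add: act_zero fun_eq_iff)
        ultimately show ?thesis by (metis map_cong)
      qed
      then show ?thesis by (rule arg_cong[where f = "\<lambda>ys. limit v (Tup t ys)"])
    qed simp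
    have "limit v z = 0" if "\<not> is_Tup z" for z
      using is_Tup_limit[OF v] that by blast
    then show ?case
      using elim(2) Tup by (intro ext) (auto simp: twist_def l_def split: idx.split)
  qed
  have "finite {z. twist g v n z \<noteq> 0}" for n
  proof -
    have "{z. twist g v n z \<noteq> 0} \<subseteq> shift (g n) ` {z. v n z \<noteq> 0}"
    proof
      fix z assume "z \<in> {z. twist g v n z \<noteq> 0}"
      then show "z \<in> shift (g n) ` {z. v n z \<noteq> 0}"
        by (intro image_eqI[of _ _ "shift (- g n) z"]) (simp_all add: twist_def)
    qed
    then show ?thesis
      using finite_support[OF v, of n] finite_surj by blast
  qed
  then show "twist g v \<in> vecs"
    by (rule vecsI[OF _ lim]) (auto simp: l_def split: idx.splits)
  show "limit (twist g v) (Tup t xs) = limit v (Tup t (map (inv_into UNIV \<sigma>) xs))"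
    by (simp add: limit_eqI[OF lim] l_def)
qed

text \<open>Translation by \<open>g n\<close> acts from the left and the map from
  \<open>Src h\<close> to \<open>shift h y\<close> multiplies from the right, so they
  commute.\<close>

lemma src_sum_twist: "src_sum (twist g v n) y z = src_sum (v n) y (shift (- g n) z)"
  unfolding src_sum_def twist_def
  by (rule sum.reindex_bij_witness[of _ "\<lambda>h. g n + h" "\<lambda>h. - g n + h"])
    (auto simp: shift_add add.assoc[symmetric])

text \<open>Composition with the twist turns each functional of \<open>S'\<close> into a functional
  of \<open>S\<close> with the same key, hence with the same prime. Only \<open>KSet\<close> refers
  to the sets, and there the limit permutation matches them.\<close>

lemma twist_grp:
  assumes ev: "\<And>i. \<forall>\<^sub>F n in sequentially. act (g n) i = \<sigma> i" and iso: "tagged_iso S S' \<sigma>"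
    and v: "v \<in> grp S"
  shows "twist g v \<in> grp S'"
proof (rule grpI)
  have \<sigma>: "bij \<sigma>" using iso by (simp add: tagged_iso_def)
  have vv: "v \<in> vecs" by (rule grp_vecs[OF v])
  show "twist g v \<in> vecs" by (rule twist_vecs(1)[OF ev \<sigma> vv])
  fix k l assume l: "l \<in> functionals S' k"
  have "\<exists>l'\<in>functionals S k. l (twist g v) = l' v"
  proof (cases k)
    case KSet
    then obtain t xs where tx: "l = (\<lambda>v. limit v (Tup t xs))" "(t, xs) \<notin> S'"
      using l by auto
    have "map \<sigma> (map (inv_into UNIV \<sigma>) xs) = xs"
      using \<sigma> by (simp add: bij_is_surj surj_iff[symmetric] surj_f_inv_f comp_def)
    then have "(t, map (inv_into UNIV \<sigma>) xs) \<notin> S"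
      using iso tx(2) unfolding tagged_iso_def by metis
    then have "(\<lambda>v. limit v (Tup t (map (inv_into UNIV \<sigma>) xs))) \<in> functionals S k"
      using KSet by auto
    then show ?thesis
      using twist_vecs(2)[OF ev \<sigma> vv] tx(1) by (intro bexI) auto
  next
    case (KMap n y)
    then consider m z where "m \<noteq> n" "l = (\<lambda>v. v m z)"
      | z where "\<not> is_Src z" "l = (\<lambda>v. v n z - src_sum (v n) y z)"
      using l by auto
    then show ?thesis
    proof cases
      case 1
      then have "(\<lambda>v. v m (shift (- g m) z)) \<in> functionals S k"
        using KMap by auto
      then show ?thesis using 1 by (intro bexI) (auto simp: twist_def)
    next
      case 2
      then have "(\<lambda>v. v n (shift (- g n) z) - src_sum (v n) y (shift (- g n) z)) \<in> functionals S k"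
        using KMap by (auto intro!: exI[of _ "shift (- g n) z"])
      then show ?thesis using 2 src_sum_twist by (intro bexI) (auto simp: twist_def)
    qed
  next
    case (KSrc n)
    then obtain m z where "m \<noteq> n \<or> \<not> is_Src z" "l = (\<lambda>v. v m z)" using l by auto
    moreover from this have "(\<lambda>v. v m (shift (- g m) z)) \<in> functionals S k"
      unfolding KSrc functionals.simps
      by (intro CollectI exI[of _ m] exI[of _ "shift (- g m) z"] conjI refl) auto
    ultimately show ?thesis by (intro bexI) (auto simp: twist_def)
  next
    case (KTgt n)
    then obtain m z where "m \<noteq> n \<or> is_Src z" "l = (\<lambda>v. v m z)" using l by auto
    moreover from this have "(\<lambda>v. v m (shift (- g m) z)) \<in> functionals S k"
      unfolding KTgt functionals.simps
      by (intro CollectI exI[of _ m] exI[of _ "shift (- g m) z"] conjI refl) auto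
    ultimately show ?thesis by (intro bexI) (auto simp: twist_def)
  next
    case (KNull n)
    then obtain z where "l = (\<lambda>v. v n z)" using l by auto
    moreover have "(\<lambda>v. v n (shift (- g n) z)) \<in> functionals S k"
      unfolding KNull functionals.simps
      by (intro CollectI exI[of _ "shift (- g n) z"] conjI refl) simp
    ultimately show ?thesis by (intro bexI) (auto simp: twist_def)
  qed
  then show "l (twist g v) \<in> local_ints (prime_of k)"
    using grp_functional[OF v] by auto
qed

text \<open>Density provides \<open>g n\<close> agreeing with \<sigma> below \<open>n\<close>. The
  inverse map is the twist by \<open>- g n\<close>, which converges to the inverse
  permutation.\<close>

lemma grp_iso_if_tagged_iso:
  assumes iso: "tagged_iso S S' \<sigma>"
  shows "\<exists>\<phi>. grp_iso S S' \<phi>"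
proof -
  have \<sigma>: "bij \<sigma>" using iso by (simp add: tagged_iso_def)
  obtain g where g: "\<And>n i. i < n \<Longrightarrow> act (g n) i = \<sigma> i"
    using act_dense[OF \<sigma>] by metis
  have ev: "\<forall>\<^sub>F n in sequentially. act (g n) i = \<sigma> i" for i
    using eventually_gt_at_top[of i] by eventually_elim (rule g)
  have ev': "\<forall>\<^sub>F n in sequentially. act (- g n) i = inv_into UNIV \<sigma> i" for i
    using ev[of "inv_into UNIV \<sigma> i"]
  proof eventually_elim
    case (elim n)
    have "act (- g n) (act (g n) (inv_into UNIV \<sigma> i)) = inv_into UNIV \<sigma> i"
      using act_add[of "- g n" "g n"] by (simp add: act_zero fun_eq_iff)
    then show ?case using elim \<sigma> by (simp add: bij_is_surj surj_f_inv_f)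
  qed
  have "(t, xs) \<in> S' \<longleftrightarrow> (t, map (inv_into UNIV \<sigma>) xs) \<in> S" for t xs
  proof -
    have "map \<sigma> (map (inv_into UNIV \<sigma>) xs) = xs"
      using \<sigma> by (simp add: bij_is_surj surj_f_inv_f comp_def)
    then show ?thesis using iso unfolding tagged_iso_def by metis
  qed
  then have iso': "tagged_iso S' S (inv_into UNIV \<sigma>)"
    using \<sigma> by (simp add: tagged_iso_def bij_imp_bij_inv)
  have "bij_betw (twist g) (grp S) (grp S')"
  proof (rule bij_betw_byWitness[where f' = "twist (\<lambda>n. - g n)"])
    show "twist g ` grp S \<subseteq> grp S'" using twist_grp[OF ev iso] by blast
    show "twist (\<lambda>n. - g n) ` grp S' \<subseteq> grp S" using twist_grp[OF ev' iso'] by blast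
  qed (simp_all add: twist_def)
  then show ?thesis
    by (intro exI[of _ "twist g"]) (simp add: grp_iso_def twist_def fun_eq_iff)
qed

theorem grp_iso_iff_tagged_iso: "(\<exists>\<phi>. grp_iso S S' \<phi>) \<longleftrightarrow> (\<exists>\<sigma>. tagged_iso S S' \<sigma>)"
  using grp_iso_if_tagged_iso tagged_iso_if_lin_iso lin_iso_extend by blast

section \<open>Coding the groups as structures on the natural numbers\<close>

definition lookup :: "('a \<times> rat) list \<Rightarrow> 'a \<Rightarrow> rat"
  where "lookup ps x = (case map_of ps x of None \<Rightarrow> 0 | Some q \<Rightarrow> q)"

lemma lookup_exists:
  assumes "finite {x. f x \<noteq> 0}"
  shows "\<exists>ps. f = lookup ps"
proof -
  obtain xs where "set xs = {x. f x \<noteq> 0}"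
    using finite_list[OF assms] by blast
  then have "f = lookup (map (\<lambda>x. (x, f x)) xs)"
    by (auto simp: lookup_def map_of_map_restrict restrict_map_def fun_eq_iff)
  then show ?thesis by blast
qed

text \<open>A vector is given by a finite table for its first \<open>N\<close> levels and a finite
  table for its limit.\<close>

lemma countable_vecs: "countable vecs"
proof -
  define build :: "(nat \<times> (nat \<times> idx \<times> rat) list \<times> (idx \<times> rat) list) \<Rightarrow> level_vec"
    where "build = (\<lambda>(N, ps, qs) n z.
      if n < N then lookup (map (\<lambda>(m, w, q). ((m, w), q)) ps) (n, z) else lookup qs z)"
  have "v \<in> range build" if v: "v \<in> vecs" for v
  proof -
    obtain N where N: "\<And>n. n \<ge> N \<Longrightarrow> v n = limit v"
      using eventually_limit[OF v] unfolding eventually_sequentially by blast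
    define f where "f = (\<lambda>(n, z). if n < N then v n z else 0)"
    have "{p. f p \<noteq> 0} \<subseteq> (\<Union>n<N. Pair n ` {z. v n z \<noteq> 0})"
      by (auto simp: f_def split: if_splits)
    moreover have "finite (\<Union>n<N. Pair n ` {z. v n z \<noteq> 0})"
      using finite_support[OF v] by blast
    ultimately obtain ps where ps: "f = lookup ps"
      using lookup_exists finite_subset by blast
    obtain qs where qs: "limit v = lookup qs"
      using lookup_exists[OF finite_support_limit[OF v]] by blast
    define ps' where "ps' = map (\<lambda>((m, w), q). (m, w, q)) ps"
    have "map (\<lambda>(m, w, q). ((m, w), q)) ps' = ps"
      by (simp add: ps'_def case_prod_unfold comp_def)
    then have "v = build (N, ps', qs)"
      using N ps[symmetric] qs[symmetric] by (auto simp: build_def fun_eq_iff f_def)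
    then show ?thesis by blast
  qed
  then have "vecs \<subseteq> range build" by blast
  then show ?thesis
    by (rule countable_subset) simp
qed

lemma enumerate_cong:
  assumes "infinite N" "infinite N'" and eq: "\<And>x. x \<le> m \<Longrightarrow> x \<in> N \<longleftrightarrow> x \<in> N'"
    and "enumerate N k \<le> m"
  shows "enumerate N' k = enumerate N k"
  using assms(4)
proof (induction k)
  case 0
  have "enumerate N 0 \<in> N" by (rule enumerate_in_set[OF assms(1)])
  then have "enumerate N 0 \<in> N'" using eq 0 by blast
  moreover have "enumerate N 0 \<le> y" if "y \<in> N'" for y
  proof (rule ccontr)
    assume "\<not> enumerate N 0 \<le> y"
    then have "y \<in> N" using eq[of y] that 0 by simp
    then show False using \<open>\<not> enumerate N 0 \<le> y\<close> by (simp add: enumerate_0 Least_le)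
  qed
  ultimately show ?case
    unfolding enumerate_0[of N'] by (intro Least_equality)
next
  case (Suc k)
  let ?e = "enumerate N (Suc k)"
  have step: "enumerate N k < ?e" using assms(1) by (rule enumerate_step)
  then have IH: "enumerate N' k = enumerate N k" using Suc by simp
  have "?e \<in> N" by (rule enumerate_in_set[OF assms(1)])
  then have "?e \<in> N'" using eq Suc.prems by blast
  moreover have "?e \<le> y" if "y \<in> N'" "enumerate N k < y" for y
  proof (rule ccontr)
    assume less: "\<not> ?e \<le> y"
    then have "y \<in> N" using eq[of y] that Suc.prems by simp
    then have "?e \<le> y"
      unfolding enumerate_Suc''[OF assms(1)] using that by (intro Least_le) simp
    then show False using less by simp
  qed
  ultimately show ?case
    unfolding enumerate_Suc''[OF assms(2)] IH using step by (intro Least_equality) auto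
qed

text \<open>The numbering \<open>to_nat_on vecs\<close> is fixed once for all \<open>S\<close>.
  Listing the members of \<open>grp S\<close> in increasing order of their codes, rather than by an
  arbitrary bijection, is what makes the coding continuous in \<open>S\<close>.\<close>

definition codes :: "(nat \<times> nat list) set \<Rightarrow> nat set"
  where "codes S = to_nat_on vecs ` grp S"

definition elem :: "(nat \<times> nat list) set \<Rightarrow> nat \<Rightarrow> level_vec"
  where "elem S k = from_nat_into vecs (enumerate (codes S) k)"

definition pos :: "(nat \<times> nat list) set \<Rightarrow> level_vec \<Rightarrow> nat"
  where "pos S v = inv_into UNIV (elem S) v"

lemma infinite_codes: "infinite (codes S)"
proof -
  define f where "f k = scale (of_nat k) (unit_vec 0 (Src 0))" for k
  have "f k \<in> grp S" for k
    unfolding f_def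
    by (rule grp_Ints[OF vecs_scale[OF unit_vec_vecs]]) (auto simp: scale_apply unit_vec_def)
  moreover have "inj f"
  proof
    fix i j assume "f i = f j"
    then have "f i 0 (Src 0) = f j 0 (Src 0)" by simp
    then show "i = j" by (simp add: f_def scale_apply unit_vec_def)
  qed
  ultimately have "infinite (grp S)"
    using infinite_super[of "range f" "grp S"] range_inj_infinite by blast
  moreover have "inj_on (to_nat_on vecs) (grp S)"
    using inj_on_to_nat_on[OF countable_vecs] by (rule inj_on_subset) (auto simp: grp_def)
  ultimately show ?thesis
    unfolding codes_def using finite_imageD by blast
qed

lemma from_nat_into_code: "v \<in> grp S \<Longrightarrow> from_nat_into vecs (to_nat_on vecs v) = v"
  using countable_vecs grp_vecs by (simp add: from_nat_into_to_nat_on)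

lemma bij_elem: "bij_betw (elem S) UNIV (grp S)"
proof -
  have "bij_betw (from_nat_into vecs) (codes S) (grp S)"
    by (rule bij_betw_byWitness[where f' = "to_nat_on vecs"])
      (auto simp: codes_def from_nat_into_code)
  then have "bij_betw (from_nat_into vecs \<circ> enumerate (codes S)) UNIV (grp S)"
    using bij_enumerate[OF infinite_codes] bij_betw_trans by blast
  moreover have "from_nat_into vecs \<circ> enumerate (codes S) = elem S"
    by (auto simp: elem_def)
  ultimately show ?thesis by simp
qed

lemma elem_grp [simp]: "elem S k \<in> grp S"
  using bij_elem by (blast dest: bij_betwE)

lemma elem_pos [simp]: "v \<in> grp S \<Longrightarrow> elem S (pos S v) = v"
  unfolding pos_def by (rule bij_betw_inv_into_right[OF bij_elem])

lemma pos_elem [simp]: "pos S (elem S k) = k"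
  unfolding pos_def by (rule bij_betw_inv_into_left[OF bij_elem]) simp

text \<open>Continuity with respect to the product topology on sets of tagged tuples.\<close>

definition locally_determined :: "((nat \<times> nat list) set \<Rightarrow> 'a) \<Rightarrow> bool"
  where "locally_determined \<Phi> \<longleftrightarrow>
    (\<forall>S. \<exists>Y. finite Y \<and> (\<forall>S'. S' \<inter> Y = S \<inter> Y \<longrightarrow> \<Phi> S' = \<Phi> S))"

text \<open>Only \<open>KSet\<close> refers to \<open>S\<close>, and it can fail for
  \<open>v\<close> only at the finitely many tuples where the limit of \<open>v\<close> is
  nonzero.\<close>

lemma locally_determined_grp: "locally_determined (\<lambda>S. v \<in> grp S)"
  unfolding locally_determined_def
proof
  fix S
  define Y where "Y = {(t, xs). limit v (Tup t xs) \<noteq> 0}"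
  show "\<exists>Y. finite Y \<and> (\<forall>S'. S' \<inter> Y = S \<inter> Y \<longrightarrow> (v \<in> grp S') = (v \<in> grp S))"
  proof (cases "v \<in> vecs")
    case False
    then show ?thesis by (intro exI[of _ "{}"]) (auto simp: grp_def)
  next
    case True
    have "finite ((\<lambda>(t, xs). Tup t xs) -` {z. limit v z \<noteq> 0})"
      by (rule finite_vimageI[OF finite_support_limit[OF True]]) (auto simp: inj_on_def)
    moreover have "(\<lambda>(t, xs). Tup t xs) -` {z. limit v z \<noteq> 0} = Y"
      by (auto simp: Y_def)
    ultimately have "finite Y" by simp
    have "v \<in> grp S2" if eq: "S1 \<inter> Y = S2 \<inter> Y" and v: "v \<in> grp S1" for S1 S2
    proof (rule grpI[OF True])
      fix k l assume l: "l \<in> functionals S2 k"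
      show "l v \<in> local_ints (prime_of k)"
      proof (cases k)
        case KSet
        then obtain t xs where tx: "l = (\<lambda>v. limit v (Tup t xs))" "(t, xs) \<notin> S2"
          using l by auto
        show ?thesis
        proof (cases "limit v (Tup t xs) = 0")
          case True
          then show ?thesis using tx by (simp add: local_ints_Ints prime_prime_of)
        next
          case False
          then have "(t, xs) \<notin> S1" using eq tx(2) by (auto simp: Y_def)
          then have "l \<in> functionals S1 k" using tx(1) KSet by auto
          then show ?thesis by (rule grp_functional[OF v])
        qed
      qed (use l grp_functional[OF v, of l k] in simp_all)
    qed
    then show ?thesis using \<open>finite Y\<close> by metis
  qed
qed

text \<open>The \<open>k\<close>-th code for \<open>S\<close> depends only on which numbers up to
  its value \<open>m\<close> are codes, hence on the membership of finitely many vectors.\<close>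

lemma locally_determined_elem: "locally_determined (\<lambda>S. elem S k)"
  unfolding locally_determined_def
proof
  fix S
  define m where "m = enumerate (codes S) k"
  have "\<forall>j. \<exists>Y. finite Y \<and> (\<forall>S'. S' \<inter> Y = S \<inter> Y \<longrightarrow>
      (from_nat_into vecs j \<in> grp S') = (from_nat_into vecs j \<in> grp S))"
    using locally_determined_grp unfolding locally_determined_def by blast
  then obtain Y where Y: "\<And>j. finite (Y j)"
    "\<And>j S'. S' \<inter> Y j = S \<inter> Y j \<Longrightarrow> (from_nat_into vecs j \<in> grp S') = (from_nat_into vecs j \<in> grp S)"
    by metis
  have "elem S' k = elem S k" if S': "S' \<inter> (\<Union>j\<le>m. Y j) = S \<inter> (\<Union>j\<le>m. Y j)" for S'
  proof -
    have code: "j \<in> codes T \<longleftrightarrow> j \<in> to_nat_on vecs ` vecs \<and> from_nat_into vecs j \<in> grp T" for j T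
    proof
      assume "j \<in> codes T"
      then show "j \<in> to_nat_on vecs ` vecs \<and> from_nat_into vecs j \<in> grp T"
        unfolding codes_def using grp_vecs from_nat_into_code by auto
    next
      assume "j \<in> to_nat_on vecs ` vecs \<and> from_nat_into vecs j \<in> grp T"
      then show "j \<in> codes T"
        unfolding codes_def using countable_vecs by auto
    qed
    have "j \<in> codes S \<longleftrightarrow> j \<in> codes S'" if "j \<le> m" for j
    proof -
      have "S' \<inter> Y j = S \<inter> Y j" using S' that by blast
      then show ?thesis unfolding code using Y(2) by blast
    qed
    moreover have "enumerate (codes S) k \<le> m" by (simp only: m_def order_refl)
    ultimately have "enumerate (codes S') k = enumerate (codes S) k"
      by (rule enumerate_cong[OF infinite_codes infinite_codes])
    then show ?thesis by (simp add: elem_def)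
  qed
  then show "\<exists>Y. finite Y \<and> (\<forall>S'. S' \<inter> Y = S \<inter> Y \<longrightarrow> elem S' k = elem S k)"
    using Y(1) by (intro exI[of _ "\<Union>j\<le>m. Y j"]) blast
qed

lemma locally_determined_pair:
  assumes "locally_determined \<Phi>" "locally_determined \<Psi>"
  shows "locally_determined (\<lambda>S. (\<Phi> S, \<Psi> S))"
  unfolding locally_determined_def
proof
  fix S
  obtain Y Z where fin: "finite (Y \<union> Z)" and
    Y: "\<And>S'. S' \<inter> Y = S \<inter> Y \<Longrightarrow> \<Phi> S' = \<Phi> S" and
    Z: "\<And>S'. S' \<inter> Z = S \<inter> Z \<Longrightarrow> \<Psi> S' = \<Psi> S"
    using assms unfolding locally_determined_def by (metis finite_UnI)
  have "(\<Phi> S', \<Psi> S') = (\<Phi> S, \<Psi> S)" if "S' \<inter> (Y \<union> Z) = S \<inter> (Y \<union> Z)" for S'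
  proof -
    have "S' \<inter> Y = S \<inter> Y" "S' \<inter> Z = S \<inter> Z" using that by blast+
    then show ?thesis using Y[of S'] Z[of S'] by simp
  qed
  then show "\<exists>Y. finite Y \<and> (\<forall>S'. S' \<inter> Y = S \<inter> Y \<longrightarrow> (\<Phi> S', \<Psi> S') = (\<Phi> S, \<Psi> S))"
    using fin by blast
qed

text \<open>Near \<open>S\<close>, both the value of \<open>\<Phi>\<close> and the element at the
  old position \<open>c\<close> stay the same, so \<open>c\<close> remains the position.\<close>

lemma locally_determined_pos:
  assumes det: "locally_determined \<Phi>" and in_grp: "\<And>S. \<Phi> S \<in> grp S"
  shows "locally_determined (\<lambda>S. pos S (\<Phi> S))"
  unfolding locally_determined_def
proof
  fix S
  define c where "c = pos S (\<Phi> S)"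
  obtain Y where Y: "finite Y"
    "\<And>S'. S' \<inter> Y = S \<inter> Y \<Longrightarrow> (\<Phi> S', elem S' c) = (\<Phi> S, elem S c)"
    using locally_determined_pair[OF det locally_determined_elem[of c]]
    unfolding locally_determined_def by meson
  have "pos S' (\<Phi> S') = pos S (\<Phi> S)" if "S' \<inter> Y = S \<inter> Y" for S'
  proof -
    have "elem S' c = \<Phi> S'"
      using Y(2)[OF that] in_grp by (simp add: c_def)
    then have "pos S' (\<Phi> S') = c" by (metis pos_elem)
    then show ?thesis by (simp add: c_def)
  qed
  then show "\<exists>Y. finite Y \<and> (\<forall>S'. S' \<inter> Y = S \<inter> Y \<longrightarrow> pos S' (\<Phi> S') = pos S (\<Phi> S))"
    using Y(1) by blast
qed

text \<open>There are no relation symbols, so the only extensional family of relations is undefined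
  everywhere.\<close>

definition coded_group :: "(nat \<times> nat list) set \<Rightarrow> fo_structure"
  where "coded_group S = (\<lambda>_. undefined,
    \<lambda>f\<in>{0, 1, 2}. \<lambda>xs\<in>tuples (fun_arity group_language f).
      if f = 0 then pos S (elem S (xs ! 0) + elem S (xs ! 1))
      else if f = 1 then pos S (- elem S (xs ! 0)) else pos S 0)"

lemma coded_group_apply [simp]:
  "snd (coded_group S) 0 [x, y] = pos S (elem S x + elem S y)"
  "snd (coded_group S) (Suc 0) [x] = pos S (- elem S x)"
  "snd (coded_group S) 2 [] = pos S 0"
  by (simp_all add: coded_group_def tuples_def group_language_def)

lemma locally_determined_coded_group:
  assumes "f \<in> {0, 1, 2}" "xs \<in> tuples (fun_arity group_language f)"
  shows "locally_determined (\<lambda>S. snd (coded_group S) f xs)"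
proof -
  have op: "locally_determined (\<lambda>S. h (elem S x) (elem S y))" for h :: "level_vec \<Rightarrow> level_vec \<Rightarrow> level_vec" and x y
    using locally_determined_pair[OF locally_determined_elem[of x] locally_determined_elem[of y]]
    unfolding locally_determined_def by (metis Pair_inject)
  have "locally_determined (\<lambda>S. pos S (elem S (xs ! 0) + elem S (xs ! 1)))"
    by (rule locally_determined_pos[OF op]) (rule grp_add[OF elem_grp elem_grp])
  moreover have "locally_determined (\<lambda>S. pos S (- elem S (xs ! 0)))"
    by (rule locally_determined_pos[OF op[of "\<lambda>v w. - v"]]) (rule grp_uminus[OF elem_grp])
  moreover have "locally_determined (\<lambda>S. pos S 0)"
    by (rule locally_determined_pos[OF op[of "\<lambda>v w. 0"]]) (rule grp_zero)
  ultimately show ?thesis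
    using assms by (auto simp: coded_group_def)
qed

lemma group_of_coded_group [simp]:
  "carrier (group_of (coded_group S)) = UNIV"
  "x \<otimes>\<^bsub>group_of (coded_group S)\<^esub> y = pos S (elem S x + elem S y)"
  "\<one>\<^bsub>group_of (coded_group S)\<^esub> = pos S 0"
  by (simp_all add: group_of_def)

lemma coded_group_TFAB: "coded_group S \<in> TFAB_omega"
proof -
  let ?G = "group_of (coded_group S)"
  have "coded_group S \<in> structures group_language"
    by (auto simp: structures_def coded_group_def group_language_def)
  moreover have comm: "comm_group ?G"
  proof (rule comm_groupI)
    fix x y z
    show "x \<otimes>\<^bsub>?G\<^esub> y \<otimes>\<^bsub>?G\<^esub> z = x \<otimes>\<^bsub>?G\<^esub> (y \<otimes>\<^bsub>?G\<^esub> z)"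
      by (simp add: grp_add add.assoc)
    show "x \<otimes>\<^bsub>?G\<^esub> y = y \<otimes>\<^bsub>?G\<^esub> x"
      by (simp add: add.commute)
    show "\<one>\<^bsub>?G\<^esub> \<otimes>\<^bsub>?G\<^esub> x = x"
      by (simp add: grp_zero)
    show "\<exists>y\<in>carrier ?G. y \<otimes>\<^bsub>?G\<^esub> x = \<one>\<^bsub>?G\<^esub>"
      by (intro bexI[of _ "pos S (- elem S x)"]) (simp_all add: grp_uminus)
  qed simp_all
  moreover have "snd (coded_group S) 1 [x] = inv\<^bsub>?G\<^esub> x" for x
  proof -
    interpret comm_group ?G by (rule comm)
    show ?thesis
      by (rule sym, rule inv_equality) (simp_all add: grp_uminus)
  qed
  moreover have "torsion_free ?G"
    unfolding torsion_free_def
  proof (intro ballI allI impI)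
    fix x and n :: nat
    assume "0 < n \<and> x [^]\<^bsub>?G\<^esub> n = \<one>\<^bsub>?G\<^esub>"
    then have n: "n > 0" and eq: "x [^]\<^bsub>?G\<^esub> n = pos S 0" by simp_all
    have pow: "x [^]\<^bsub>?G\<^esub> k = pos S (scale (of_nat k) (elem S x))" for k :: nat
    proof (induction k)
      case 0
      show ?case by (simp only: of_nat_0 scale_zero nat_pow_0 group_of_coded_group)
    next
      case (Suc k)
      have "x [^]\<^bsub>?G\<^esub> Suc k = pos S (scale (of_nat k) (elem S x) + elem S x)"
        using Suc by (simp add: grp_scale_of_nat)
      also have "scale (of_nat k) (elem S x) + elem S x = scale (of_nat (Suc k)) (elem S x)"
        by (simp only: of_nat_Suc scale_add_left scale_one add.commute)
      finally show ?case .
    qed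
    have "elem S (pos S (scale (of_nat n) (elem S x))) = elem S (pos S 0)"
      using pow[of n] eq by simp
    then have "scale (of_nat n) (elem S x) = 0"
      by (simp only: elem_pos grp_zero grp_scale_of_nat elem_grp)
    then have "scale (of_nat n) (elem S x) m z = 0" for m z by simp
    then have "elem S x = 0"
      using n by (simp add: scale_apply fun_eq_iff)
    then show "x = \<one>\<^bsub>?G\<^esub>"
      by (metis group_of_coded_group(3) pos_elem)
  qed
  ultimately show ?thesis by (simp add: TFAB_omega_def)
qed

lemma isomorphic_group_language:
  "isomorphic group_language A B \<longleftrightarrow> (\<exists>h. bij h \<and>
    (\<forall>x y. h (snd A 0 [x, y]) = snd B 0 [h x, h y]) \<and>
    (\<forall>x. h (snd A 1 [x]) = snd B 1 [h x]) \<and> h (snd A 2 []) = snd B 2 [])"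
proof -
  have "(\<forall>xs\<in>tuples 2. P xs) \<longleftrightarrow> (\<forall>x y. P [x, y])" "(\<forall>xs\<in>tuples 1. P xs) \<longleftrightarrow> (\<forall>x. P [x])"
    "(\<forall>xs\<in>tuples 0. P xs) \<longleftrightarrow> P []" for P :: "nat list \<Rightarrow> bool"
    by (auto simp: tuples_def length_Suc_conv numeral_2_eq_2)
  then show ?thesis
    unfolding isomorphic_def group_language_def by simp
qed

lemma isomorphic_coded_group:
  "isomorphic group_language (coded_group S) (coded_group S') \<longleftrightarrow> (\<exists>\<phi>. grp_iso S S' \<phi>)"
proof
  assume "isomorphic group_language (coded_group S) (coded_group S')"
  then obtain h where h: "bij h"
    "\<And>x y. h (pos S (elem S x + elem S y)) = pos S' (elem S' (h x) + elem S' (h y))"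
    unfolding isomorphic_group_language coded_group_apply by blast
  define \<phi> where "\<phi> = elem S' \<circ> h \<circ> pos S"
  have "bij_betw (pos S) (grp S) UNIV"
    unfolding pos_def by (rule bij_betw_inv_into[OF bij_elem])
  then have "bij_betw \<phi> (grp S) (grp S')"
    unfolding \<phi>_def using bij_elem h(1) by (blast intro: bij_betw_trans)
  moreover have "\<phi> (v + w) = \<phi> v + \<phi> w" if "v \<in> grp S" "w \<in> grp S" for v w
    using h(2)[of "pos S v" "pos S w"] that by (simp add: \<phi>_def grp_add)
  ultimately show "\<exists>\<phi>. grp_iso S S' \<phi>"
    unfolding grp_iso_def by blast
next
  assume "\<exists>\<phi>. grp_iso S S' \<phi>"
  then obtain \<phi> where \<phi>: "grp_iso S S' \<phi>" by blast
  define h where "h = pos S' \<circ> \<phi> \<circ> elem S"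
  have "bij_betw (pos S') (grp S') UNIV"
    unfolding pos_def by (rule bij_betw_inv_into[OF bij_elem])
  then have bij: "bij h"
    unfolding h_def using bij_elem \<phi> unfolding grp_iso_def by (blast intro: bij_betw_trans)
  have elem_h: "elem S' (h x) = \<phi> (elem S x)" for x
    by (simp add: h_def grp_iso_in[OF \<phi>])
  have h_pos: "h (pos S v) = pos S' (\<phi> v)" if "v \<in> grp S" for v
    using that by (simp add: h_def)
  have neg: "\<phi> (- v) = - \<phi> v" if "v \<in> grp S" for v
    using grp_iso_scale_of_int[OF \<phi> that, of "- 1"] by (simp add: scale_minus_one)
  have zero: "\<phi> 0 = 0"
    using grp_iso_scale_of_int[OF \<phi> grp_zero, of 0] by (simp only: of_int_0 scale_zero)
  show "isomorphic group_language (coded_group S) (coded_group S')"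
    unfolding isomorphic_group_language
    by (intro exI[of _ h] conjI allI bij)
      (simp_all only: coded_group_apply One_nat_def h_pos elem_h grp_add grp_uminus grp_zero elem_grp
        grp_iso_add[OF \<phi>] neg zero)
qed

text \<open>Even tags are for relations, odd tags for graphs of functions, with the value in front.\<close>

definition encode :: "fo_language \<Rightarrow> fo_structure \<Rightarrow> (nat \<times> nat list) set"
  where "encode L A =
    {(2 * R, xs) | R xs. R \<in> rel_syms L \<and> xs \<in> tuples (rel_arity L R) \<and> fst A R xs} \<union>
    {(2 * f + 1, snd A f xs # xs) | f xs. f \<in> fun_syms L \<and> xs \<in> tuples (fun_arity L f)}"

lemma encode_rel:
  "(2 * R, xs) \<in> encode L A \<longleftrightarrow> R \<in> rel_syms L \<and> xs \<in> tuples (rel_arity L R) \<and> fst A R xs"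
  by (auto simp: encode_def) presburger+

lemma encode_fun:
  "(2 * f + 1, ys) \<in> encode L A \<longleftrightarrow>
    f \<in> fun_syms L \<and> (\<exists>xs\<in>tuples (fun_arity L f). ys = snd A f xs # xs)"
  by (auto simp: encode_def) presburger+

lemma map_tuples [simp]: "map h xs \<in> tuples n \<longleftrightarrow> xs \<in> tuples n"
  by (simp add: tuples_def)

lemma isomorphic_iff_tagged_iso:
  "isomorphic L A B \<longleftrightarrow> (\<exists>\<sigma>. tagged_iso (encode L A) (encode L B) \<sigma>)"
proof
  assume "isomorphic L A B"
  then obtain h where h: "bij h"
    "\<And>R xs. R \<in> rel_syms L \<Longrightarrow> xs \<in> tuples (rel_arity L R) \<Longrightarrow> fst A R xs \<longleftrightarrow> fst B R (map h xs)"
    "\<And>f xs. f \<in> fun_syms L \<Longrightarrow> xs \<in> tuples (fun_arity L f) \<Longrightarrow> h (snd A f xs) = snd B f (map h xs)"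
    unfolding isomorphic_def by blast
  have "(t, xs) \<in> encode L A \<longleftrightarrow> (t, map h xs) \<in> encode L B" for t xs
  proof (cases "even t")
    case True
    then obtain R where "t = 2 * R" by (auto elim: evenE)
    then show ?thesis using h(2) by (auto simp: encode_rel)
  next
    case False
    then obtain f where t: "t = 2 * f + 1" by (auto elim: oddE)
    have "(\<exists>ys\<in>tuples (fun_arity L f). xs = snd A f ys # ys) \<longleftrightarrow>
        (\<exists>ys\<in>tuples (fun_arity L f). map h xs = snd B f ys # ys)" if f: "f \<in> fun_syms L"
    proof
      assume "\<exists>ys\<in>tuples (fun_arity L f). xs = snd A f ys # ys"
      then show "\<exists>ys\<in>tuples (fun_arity L f). map h xs = snd B f ys # ys"
        using h(3)[OF f] by auto
    next
      assume "\<exists>ys\<in>tuples (fun_arity L f). map h xs = snd B f ys # ys"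
      then obtain x ys where ys: "xs = x # ys" "ys \<in> tuples (fun_arity L f)" "h x = snd B f (map h ys)"
        by auto
      then have "h x = h (snd A f ys)" using h(3)[OF f] by simp
      then have "x = snd A f ys" using h(1) by (simp add: bij_is_inj inj_eq)
      then show "\<exists>ys\<in>tuples (fun_arity L f). xs = snd A f ys # ys" using ys by blast
    qed
    then show ?thesis unfolding t encode_fun by (rule conj_cong[OF refl])
  qed
  then show "\<exists>\<sigma>. tagged_iso (encode L A) (encode L B) \<sigma>"
    using h(1) unfolding tagged_iso_def by blast
next
  assume "\<exists>\<sigma>. tagged_iso (encode L A) (encode L B) \<sigma>"
  then obtain \<sigma> where \<sigma>: "bij \<sigma>" "\<And>t xs. (t, xs) \<in> encode L A \<longleftrightarrow> (t, map \<sigma> xs) \<in> encode L B"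
    unfolding tagged_iso_def by blast
  have "fst A R xs \<longleftrightarrow> fst B R (map \<sigma> xs)" if "R \<in> rel_syms L" "xs \<in> tuples (rel_arity L R)" for R xs
    using \<sigma>(2)[of "2 * R" xs] that by (simp add: encode_rel)
  moreover have "\<sigma> (snd A f xs) = snd B f (map \<sigma> xs)"
    if "f \<in> fun_syms L" "xs \<in> tuples (fun_arity L f)" for f xs
  proof -
    have "(2 * f + 1, snd A f xs # xs) \<in> encode L A"
      unfolding encode_fun using that by blast
    then show ?thesis
      unfolding \<sigma>(2) encode_fun by auto
  qed
  ultimately show "isomorphic L A B"
    unfolding isomorphic_def using \<sigma>(1) by blast
qed

theorem isomorphic_iff_coded:
  "isomorphic L A B \<longleftrightarrow>
    isomorphic group_language (coded_group (encode L A)) (coded_group (encode L B))"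
  unfolding isomorphic_coded_group grp_iso_iff_tagged_iso isomorphic_iff_tagged_iso[of L] ..

section \<open>Continuity of the coding map\<close>

lemma continuous_map_nested_projection:
  assumes "continuous_map X (product_topology (\<lambda>i. product_topology (T i) (J i)) I) f" "i \<in> I" "j \<in> J i"
  shows "continuous_map X (T i j) (\<lambda>x. f x i j)"
  using assms unfolding continuous_map_componentwise by blast

lemma continuous_map_fst_component:
  assumes "R \<in> rel_syms L" "xs \<in> tuples (rel_arity L R)"
  shows "continuous_map (structure_topology L) (discrete_topology UNIV) (\<lambda>A. fst A R xs)"
  unfolding structure_topology_def
  by (rule continuous_map_nested_projection[where f = fst and i = R and j = xs and
        T = "\<lambda>_ _. discrete_topology UNIV" and I = "rel_syms L" and J = "\<lambda>R. tuples (rel_arity L R)"])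
    (rule continuous_map_fst assms)+

lemma continuous_map_snd_component:
  assumes "f \<in> fun_syms L" "xs \<in> tuples (fun_arity L f)"
  shows "continuous_map (structure_topology L) (discrete_topology UNIV) (\<lambda>A. snd A f xs)"
  unfolding structure_topology_def
  by (rule continuous_map_nested_projection[where f = snd and i = f and j = xs and
        T = "\<lambda>_ _. discrete_topology UNIV" and I = "fun_syms L" and J = "\<lambda>f. tuples (fun_arity L f)"])
    (rule continuous_map_snd assms)+

text \<open>Membership of one tagged tuple is a single atomic condition on the structure, or
  constantly false when the tag or the length does not fit.\<close>

lemma continuous_map_mem_encode:
  "continuous_map (structure_topology L) (discrete_topology UNIV) (\<lambda>A. (t, xs) \<in> encode L A)"
proof (cases "even t")
  case True
  then obtain R where t: "t = 2 * R" by (auto elim: evenE)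
  show ?thesis
  proof (cases "R \<in> rel_syms L \<and> xs \<in> tuples (rel_arity L R)")
    case True
    then show ?thesis
      unfolding t encode_rel using continuous_map_fst_component by simp
  next
    case False
    then have "(t, xs) \<notin> encode L A" for A
      unfolding t encode_rel by blast
    then show ?thesis by simp
  qed
next
  case False
  then obtain f where t: "t = 2 * f + 1" by (auto elim: oddE)
  show ?thesis
  proof (cases "f \<in> fun_syms L \<and> (\<exists>y ys. xs = y # ys \<and> ys \<in> tuples (fun_arity L f))")
    case True
    then obtain y ys where ys: "f \<in> fun_syms L" "xs = y # ys" "ys \<in> tuples (fun_arity L f)" by blast
    then have "(t, xs) \<in> encode L A \<longleftrightarrow> snd A f ys = y" for A
      unfolding t encode_fun by auto
    moreover have "continuous_map (structure_topology L) (discrete_topology UNIV) (\<lambda>A. snd A f ys = y)"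
      using continuous_map_compose[OF continuous_map_snd_component[OF ys(1,3)],
          of "discrete_topology UNIV" "\<lambda>z. z = y"]
      by (simp add: comp_def)
    ultimately show ?thesis by simp
  next
    case False
    then have "(t, xs) \<notin> encode L A" for A
      unfolding t encode_fun by blast
    then show ?thesis by simp
  qed
qed

lemma encode_locally_constant:
  assumes "finite Y" "A \<in> structures L"
  shows "\<exists>U. openin (structure_topology L) U \<and> A \<in> U \<and>
    (\<forall>B\<in>U. encode L B \<inter> Y = encode L A \<inter> Y)"
  using assms(1)
proof induction
  case empty
  then show ?case
    using assms(2) openin_topspace[of "structure_topology L"]
    by (intro exI[of _ "structures L"]) simp
next
  case (insert y Y)
  obtain t xs where y: "y = (t, xs)" by fastforce
  obtain U where U: "openin (structure_topology L) U" "A \<in> U"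
    "\<forall>B\<in>U. encode L B \<inter> Y = encode L A \<inter> Y"
    using insert by blast
  define V where "V = {B \<in> structures L. ((t, xs) \<in> encode L B) \<in> {(t, xs) \<in> encode L A}}"
  have open_V: "openin (structure_topology L) V"
    using openin_continuous_map_preimage[OF continuous_map_mem_encode[of L t xs],
        of "{(t, xs) \<in> encode L A}"]
    by (simp add: V_def)
  have "A \<in> V" using assms(2) by (simp add: V_def)
  have V: "encode L B \<inter> insert y Y = encode L A \<inter> insert y Y" if "B \<in> U \<inter> V" for B
  proof -
    have "encode L B \<inter> Y = encode L A \<inter> Y" "y \<in> encode L B \<longleftrightarrow> y \<in> encode L A"
      using that U(3) by (auto simp: V_def y)
    then show ?thesis by blast
  qed
  show ?case
    by (intro exI[of _ "U \<inter> V"] conjI ballI openin_Int IntI U(1,2) open_V V \<open>A \<in> V\<close>) auto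
qed

text \<open>The part of \<open>encode L A\<close> inside a finite \<open>Y\<close> is constant on a
  neighbourhood of \<open>A\<close>, so a locally determined value is locally constant.\<close>

lemma continuous_map_locally_determined:
  assumes "locally_determined \<Phi>"
  shows "continuous_map (structure_topology L) (discrete_topology UNIV) (\<lambda>A. \<Phi> (encode L A))"
  unfolding continuous_map_def
proof (intro conjI allI impI)
  fix W
  show "openin (structure_topology L) {A \<in> topspace (structure_topology L). \<Phi> (encode L A) \<in> W}"
  proof (subst openin_subopen, intro ballI)
    fix A assume A: "A \<in> {A \<in> topspace (structure_topology L). \<Phi> (encode L A) \<in> W}"
    obtain Y where Y: "finite Y" "\<And>S. S \<inter> Y = encode L A \<inter> Y \<Longrightarrow> \<Phi> S = \<Phi> (encode L A)"
      using assms unfolding locally_determined_def by meson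
    obtain U where U: "openin (structure_topology L) U" "A \<in> U"
      "\<And>B. B \<in> U \<Longrightarrow> encode L B \<inter> Y = encode L A \<inter> Y"
      using encode_locally_constant[OF Y(1), of A L] A by auto
    have "U \<subseteq> {A \<in> topspace (structure_topology L). \<Phi> (encode L A) \<in> W}"
    proof
      fix B assume B: "B \<in> U"
      then have "\<Phi> (encode L B) = \<Phi> (encode L A)"
        by (intro Y(2) U(3))
      moreover have "B \<in> topspace (structure_topology L)"
        using openin_subset[OF U(1)] B by blast
      ultimately show "B \<in> {A \<in> topspace (structure_topology L). \<Phi> (encode L A) \<in> W}"
        using A by simp
    qed
    then show "\<exists>T. openin (structure_topology L) T \<and> A \<in> T \<and>
        T \<subseteq> {A \<in> topspace (structure_topology L). \<Phi> (encode L A) \<in> W}"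
      using U by blast
  qed
qed simp

lemma continuous_map_coded_group:
  "continuous_map (class_topology L K) (class_topology group_language TFAB_omega)
    (\<lambda>A. coded_group (encode L A))"
proof -
  have fst: "fst (coded_group S) = (\<lambda>_. undefined)" for S
    by (simp add: coded_group_def)
  have "continuous_map (structure_topology L)
      (product_topology (\<lambda>R. product_topology (\<lambda>_. discrete_topology UNIV)
        (tuples (rel_arity group_language R))) (rel_syms group_language))
      (\<lambda>A. fst (coded_group (encode L A)))"
    unfolding continuous_map_componentwise fst by (auto simp: group_language_def)
  moreover have "continuous_map (structure_topology L)
      (product_topology (\<lambda>f. product_topology (\<lambda>_. discrete_topology UNIV)
        (tuples (fun_arity group_language f))) (fun_syms group_language))
      (\<lambda>A. snd (coded_group (encode L A)))"
    unfolding continuous_map_componentwise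
  proof (intro conjI ballI)
    show "(\<lambda>A. snd (coded_group (encode L A))) ` topspace (structure_topology L)
        \<subseteq> extensional (fun_syms group_language)"
      by (auto simp: coded_group_def group_language_def)
  next
    fix f assume f: "f \<in> fun_syms group_language"
    then have f': "f \<in> {0, 1, 2}" by (simp add: group_language_def)
    show "(\<lambda>A. snd (coded_group (encode L A)) f) ` topspace (structure_topology L)
        \<subseteq> extensional (tuples (fun_arity group_language f))"
      using f' by (auto simp: coded_group_def)
    fix xs assume "xs \<in> tuples (fun_arity group_language f)"
    then show "continuous_map (structure_topology L) (discrete_topology UNIV)
        (\<lambda>A. snd (coded_group (encode L A)) f xs)"
      by (intro continuous_map_locally_determined locally_determined_coded_group f')
  qed
  ultimately have "continuous_map (structure_topology L) (structure_topology group_language)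
      (\<lambda>A. coded_group (encode L A))"
    unfolding structure_topology_def[of group_language] continuous_map_pairwise
    by (simp add: comp_def)
  then show ?thesis
    unfolding class_topology_def
    by (intro continuous_map_into_subtopology continuous_map_from_subtopology)
      (auto simp: coded_group_TFAB)
qed

section \<open>Borel sets and the theorem\<close>

lemma space_borel_of [simp]: "space (borel_of X) = topspace X"
  unfolding borel_of_def by (rule space_measure_of) (auto dest: openin_subset)

lemma openin_borel_of: "openin X U \<Longrightarrow> U \<in> sets (borel_of X)"
  unfolding borel_of_def by (subst sets_measure_of) (auto dest: openin_subset)

lemma continuous_map_borel_of:
  assumes "continuous_map X Y f"
  shows "f \<in> measurable (borel_of X) (borel_of Y)"
  unfolding borel_of_def[of Y]
proof (rule measurable_measure_of)
  show "{U. openin Y U} \<subseteq> Pow (topspace Y)" by (auto dest: openin_subset)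
  show "f \<in> space (borel_of X) \<rightarrow> topspace Y"
    using continuous_map_funspace[OF assms] by simp
  fix U assume "U \<in> {U. openin Y U}"
  then have "openin X {x \<in> topspace X. f x \<in> U}"
    using openin_continuous_map_preimage[OF assms] by blast
  moreover have "f -` U \<inter> space (borel_of X) = {x \<in> topspace X. f x \<in> U}" by auto
  ultimately show "f -` U \<inter> space (borel_of X) \<in> sets (borel_of X)"
    by (simp add: openin_borel_of)
qed

lemma continuous_map_discrete_measurable:
  assumes "continuous_map X (discrete_topology UNIV) f"
  shows "f \<in> measurable (borel_of X) (count_space UNIV)"
proof (rule measurableI)
  fix W
  have "openin X {x \<in> topspace X. f x \<in> W}"
    using openin_continuous_map_preimage[OF assms] by simp
  moreover have "f -` W \<inter> space (borel_of X) = {x \<in> topspace X. f x \<in> W}" by auto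
  ultimately show "f -` W \<inter> space (borel_of X) \<in> sets (borel_of X)"
    by (simp add: openin_borel_of)
qed simp

text \<open>With the inverse as an operation \<open>i\<close>, the existential quantifier in the
  group axioms disappears and only identities remain, which define Borel sets directly.\<close>

lemma comm_group_with_inverse_iff:
  assumes "carrier G = UNIV"
  shows "comm_group G \<and> (\<forall>x. i x = inv\<^bsub>G\<^esub> x) \<longleftrightarrow>
    (\<forall>x y z. x \<otimes>\<^bsub>G\<^esub> y \<otimes>\<^bsub>G\<^esub> z = x \<otimes>\<^bsub>G\<^esub> (y \<otimes>\<^bsub>G\<^esub> z)) \<and>
    (\<forall>x y. x \<otimes>\<^bsub>G\<^esub> y = y \<otimes>\<^bsub>G\<^esub> x) \<and> (\<forall>x. \<one>\<^bsub>G\<^esub> \<otimes>\<^bsub>G\<^esub> x = x) \<and>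
    (\<forall>x. i x \<otimes>\<^bsub>G\<^esub> x = \<one>\<^bsub>G\<^esub>)" (is "?L \<longleftrightarrow> ?R")
proof
  assume L: ?L
  then interpret comm_group G by simp
  show ?R
  proof (intro conjI allI)
    fix x y z
    show "x \<otimes>\<^bsub>G\<^esub> y \<otimes>\<^bsub>G\<^esub> z = x \<otimes>\<^bsub>G\<^esub> (y \<otimes>\<^bsub>G\<^esub> z)"
      by (rule m_assoc) (simp_all add: assms)
    show "x \<otimes>\<^bsub>G\<^esub> y = y \<otimes>\<^bsub>G\<^esub> x"
      by (rule m_comm) (simp_all add: assms)
    show "\<one>\<^bsub>G\<^esub> \<otimes>\<^bsub>G\<^esub> x = x" "i x \<otimes>\<^bsub>G\<^esub> x = \<one>\<^bsub>G\<^esub>"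
      using L by (simp_all add: assms l_inv)
  qed
next
  assume R: ?R
  then have left_inverse: "i x \<otimes>\<^bsub>G\<^esub> x = \<one>\<^bsub>G\<^esub>" for x by blast
  have in_carrier: "x \<in> carrier G" for x by (simp add: assms)
  interpret comm_group G
  proof (rule comm_groupI)
    show "\<exists>y\<in>carrier G. y \<otimes>\<^bsub>G\<^esub> x = \<one>\<^bsub>G\<^esub>" for x
      by (rule bexI, rule left_inverse, rule in_carrier)
  qed (use R assms in auto)
  show ?L
  proof (intro conjI allI comm_group_axioms)
    show "i x = inv\<^bsub>G\<^esub> x" for x
      by (rule inv_equality[OF left_inverse in_carrier in_carrier, symmetric])
  qed
qed

text \<open>Each axiom is a countable conjunction, over natural numbers, of Boolean combinations of
  equations between terms; every term is a measurable function of the structure with values in a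
  countable discrete space.\<close>

lemma borel_class_TFAB: "borel_class group_language TFAB_omega"
proof -
  define M where "M = borel_of (structure_topology group_language)"
  have space: "space M = structures group_language" by (simp add: M_def)
  have component: "(\<lambda>A. snd A f xs) \<in> measurable M (count_space UNIV)"
    if "f \<in> {0, 1, 2}" "xs \<in> tuples (fun_arity group_language f)" for f xs
    unfolding M_def
    by (intro continuous_map_discrete_measurable continuous_map_snd_component)
      (use that in \<open>simp_all add: group_language_def\<close>)
  have inv: "(\<lambda>A. snd A 1 [x]) \<in> measurable M (count_space UNIV)" for x
    by (rule component) (simp_all add: group_language_def tuples_def)
  have one: "(\<lambda>A. snd A 2 []) \<in> measurable M (count_space UNIV)"
    by (rule component) (simp_all add: group_language_def tuples_def)
  \<comment> \<open>This handles nested terms: splitting by the countably many values of the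
    arguments reduces the claim to fixed arguments \<open>[x, y]\<close>.\<close>
  have mult: "(\<lambda>A. snd A 0 [f A, g A]) \<in> measurable M (count_space UNIV)"
    if f: "f \<in> measurable M (count_space UNIV)" and g: "g \<in> measurable M (count_space UNIV)"
    for f g :: "fo_structure \<Rightarrow> nat"
  proof -
    have "(\<lambda>A. snd A 0 [x, y]) \<in> measurable M (count_space UNIV)" for x y
      by (rule component) (simp_all add: group_language_def tuples_def)
    then have "(\<lambda>A. snd A 0 [x, g A]) \<in> measurable M (count_space UNIV)" for x
      by (rule measurable_compose_countable[OF _ g])
    then show ?thesis by (rule measurable_compose_countable[OF _ f])
  qed
  have pow: "(\<lambda>A. x [^]\<^bsub>group_of A\<^esub> n) \<in> measurable M (count_space UNIV)" for x and n :: nat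
  proof (induction n)
    case 0
    then show ?case using one by (simp add: group_of_def)
  next
    case (Suc n)
    have "x [^]\<^bsub>group_of A\<^esub> Suc n = snd A 0 [x [^]\<^bsub>group_of A\<^esub> n, x]" for A
      by (simp add: group_of_def)
    then show ?case using mult[OF Suc, of "\<lambda>_. x"] by simp
  qed
  have eq: "Measurable.pred M (\<lambda>A. f A = g A)"
    if [measurable]: "f \<in> measurable M (count_space UNIV)" "g \<in> measurable M (count_space UNIV)"
    for f g :: "fo_structure \<Rightarrow> nat"
  proof -
    \<comment> \<open>Splitting over the common value turns equality into a countable union.\<close>
    have "(\<lambda>A. f A = g A) = (\<lambda>A. \<exists>k. f A = k \<and> g A = k)" by auto
    also have "Measurable.pred M \<dots>" by measurable
    finally show ?thesis .
  qed
  have "A \<in> TFAB_omega \<longleftrightarrow> A \<in> space M \<and>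
      ((\<forall>x y z. snd A 0 [snd A 0 [x, y], z] = snd A 0 [x, snd A 0 [y, z]]) \<and>
      (\<forall>x y. snd A 0 [x, y] = snd A 0 [y, x]) \<and> (\<forall>x. snd A 0 [snd A 2 [], x] = x) \<and>
      (\<forall>x. snd A 0 [snd A 1 [x], x] = snd A 2 []) \<and>
      (\<forall>x (n :: nat). 0 < n \<and> x [^]\<^bsub>group_of A\<^esub> n = snd A 2 [] \<longrightarrow> x = snd A 2 []))" for A
    unfolding TFAB_omega_def space torsion_free_def
    using comm_group_with_inverse_iff[of "group_of A" "\<lambda>x. snd A 1 [x]"]
    by (simp add: group_of_def conj_assoc) blast
  then have "TFAB_omega = {A \<in> space M.
      (\<forall>x y z. snd A 0 [snd A 0 [x, y], z] = snd A 0 [x, snd A 0 [y, z]]) \<and>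
      (\<forall>x y. snd A 0 [x, y] = snd A 0 [y, x]) \<and> (\<forall>x. snd A 0 [snd A 2 [], x] = x) \<and>
      (\<forall>x. snd A 0 [snd A 1 [x], x] = snd A 2 []) \<and>
      (\<forall>x (n :: nat). 0 < n \<and> x [^]\<^bsub>group_of A\<^esub> n = snd A 2 [] \<longrightarrow> x = snd A 2 [])}"
    by blast
  also have "\<dots> \<in> sets M"
    by (intro predE pred_intros_countable pred_intros_logic eq mult pow inv one measurable_const) auto
  finally show ?thesis
    unfolding borel_class_def M_def .
qed

theorem mainTheorem1:
  "borel_complete group_language TFAB_omega \<and>
   (\<exists>\<B> :: fo_structure \<Rightarrow> fo_structure.
      continuous_map (class_topology graph_language Graph_omega)
        (class_topology group_language TFAB_omega) \<B> \<and>
      (\<forall>H1\<in>Graph_omega. \<forall>H2\<in>Graph_omega.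
        isomorphic graph_language H1 H2 \<longleftrightarrow> isomorphic group_language (\<B> H1) (\<B> H2)))"
proof
  show "borel_complete group_language TFAB_omega"
    unfolding borel_complete_def
  proof (intro conjI allI impI borel_class_TFAB)
    \<comment> \<open>The coding is continuous for every language, hence Borel; its instance at
      \<open>graph_language\<close> is the map of the second conjunct.\<close>
    fix L2 K2
    show "\<exists>F\<in>measurable (borel_of (class_topology L2 K2))
          (borel_of (class_topology group_language TFAB_omega)).
        \<forall>A\<in>K2. \<forall>B\<in>K2. isomorphic L2 A B \<longleftrightarrow> isomorphic group_language (F A) (F B)"
    proof (rule bexI)
      show "\<forall>A\<in>K2. \<forall>B\<in>K2. isomorphic L2 A B \<longleftrightarrow>
          isomorphic group_language (coded_group (encode L2 A)) (coded_group (encode L2 B))"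
        using isomorphic_iff_coded by blast
    qed (rule continuous_map_borel_of[OF continuous_map_coded_group])
  qed
  show "\<exists>\<B>. continuous_map (class_topology graph_language Graph_omega)
        (class_topology group_language TFAB_omega) \<B> \<and>
      (\<forall>H1\<in>Graph_omega. \<forall>H2\<in>Graph_omega.
        isomorphic graph_language H1 H2 \<longleftrightarrow> isomorphic group_language (\<B> H1) (\<B> H2))"
    by (intro exI[of _ "\<lambda>H. coded_group (encode graph_language H)"] conjI ballI
        continuous_map_coded_group isomorphic_iff_coded)
qed

end
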